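(* Let $N\in\{2,3\}$, let $k>0$, let $R>0$, let $S=\partial B(0,R)\subset\mathbb{R}^N$ (a circle if $N=2$, a sphere if $N=3$), and let $\Omega$ be a nonempty open set contained in the open ball $B(0,R)$. Define the operator $\mathcal{T}: L^2(S)\to C^\infty(\Omega)$ by $$\mathcal{T}(u)(x):=\langle u, G(x,\cdot)\rangle_{L^2(S)}=\int_S u(y)\,\overline{G(x,y)}\,ds(y),\qquad x\in\Omega .$$ Then $\mathcal{T}$ is injective: if $u_1,u_2\in L^2(S)$ satisfy $\mathcal{T}(u_1)(x)=\mathcal{T}(u_2)(x)$ for all $x\in\Omega$, then $u_1=u_2$ in $L^2(S)$.
   Context: $G$ is the free-space Green's function of the Helmholtz equation with wavenumber $k$: $G(x,y)=\frac{\mathbf{i}}{4}H_0^{(1)}(k|x-y|)$ for $N=2$, where $H_0^{(1)}$ is the Hankel function of the first kind of order $0$, and $G(x,y)=\frac{\exp(-\mathbf{i}k|x-y|)}{4\pi|x-y|}$ for $N=3$. The bar denotes complex conjugation and $ds$ is the surface (arc-length) measure on $S$. *)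

theory Defs
  imports "HOL-Analysis.Analysis"
begin

definition bessel_J0 :: "real \<Rightarrow> real" where
  "bessel_J0 z = (\<Sum>m. (-1) ^ m * (z / 2) ^ (2 * m) / (fact m) ^ 2)"

definition bessel_Y0 :: "real \<Rightarrow> real" where
  "bessel_Y0 z = 2 / pi * (ln (z / 2) + euler_mascheroni) * bessel_J0 z
     + 2 / pi * (\<Sum>m. (-1) ^ m * harm (Suc m) * (z / 2) ^ (2 * Suc m) / (fact (Suc m)) ^ 2)"

definition hankel1_0 :: "real \<Rightarrow> complex" where
  "hankel1_0 z = Complex (bessel_J0 z) (bessel_Y0 z)"

definition helmholtz_green :: "real \<Rightarrow> 'a::euclidean_space \<Rightarrow> 'a \<Rightarrow> complex" where
  "helmholtz_green k x y =
     (if DIM('a) = 2 then \<i> / 4 * hankel1_0 (k * dist x y)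
      else exp (- \<i> * complex_of_real (k * dist x y)) / complex_of_real (4 * pi * dist x y))"

text \<open>Surface measure on the sphere of radius R centred at 0, defined as the cone measure:
  sigma(A) = (N / R) * Lebesgue measure of {t x | x in A, 0 < t <= 1}, realised as the
  push-forward of (N/R) times Lebesgue measure on the ball under radial projection.\<close>

definition sphere_surface_measure :: "real \<Rightarrow> 'a::euclidean_space measure" where
  "sphere_surface_measure R =
     distr (density (restrict_space lborel (ball 0 R)) (\<lambda>_. ennreal (real DIM('a) / R)))
       borel (\<lambda>x. (R / norm x) *\<^sub>R x)"

definition helmholtz_T :: "real \<Rightarrow> real \<Rightarrow> ('a::euclidean_space \<Rightarrow> complex) \<Rightarrow> 'a \<Rightarrow> complex" where
  "helmholtz_T k R u x =
     integral\<^sup>L (sphere_surface_measure R) (\<lambda>y. u y * cnj (helmholtz_green k x y))"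

definition in_L2_sphere :: "real \<Rightarrow> ('a::euclidean_space \<Rightarrow> complex) \<Rightarrow> bool" where
  "in_L2_sphere R u \<longleftrightarrow> u \<in> borel_measurable (sphere_surface_measure R)
     \<and> integrable (sphere_surface_measure R) (\<lambda>y. (cmod (u y))\<^sup>2)"

end

theory Submission
  imports Defs "HOL-Complex_Analysis.Complex_Analysis"
begin

text \<open>
  In both dimensions the conjugate of \<open>G(x,y)\<close> equals \<open>\<phi>(|x - y|\<^sup>2)\<close> for a function \<open>\<phi>\<close> that is
  holomorphic on the right half-plane and solves \<open>s \<phi>'' + a \<phi>' + c \<phi> = 0\<close> with \<open>a = N/2\<close> and
  \<open>c = k\<^sup>2/4\<close>. Let \<open>u\<close> be the difference of two densities with equal potentials on \<open>\<Omega>\<close>. Along segments the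
  potential of \<open>u\<close> extends holomorphically in the segment parameter, so it vanishes on the whole ball.
  At \<open>x = t b\<close> and \<open>|y| = R\<close> one has \<open>|x - y|\<^sup>2 = R\<^sup>2 + t (t |b|\<^sup>2 - 2 b \<bullet> y)\<close>. Expanding
  \<open>\<phi>\<close> at \<open>R\<^sup>2\<close> and comparing the coefficients of \<open>t^n\<close> gives, by induction on \<open>n\<close>,
  \<open>\<phi>\<^sup>(\<^sup>n\<^sup>)(R\<^sup>2) \<integral> u(y) (b \<bullet> y)^n ds(y) = 0\<close>. No derivative \<open>\<phi>\<^sup>(\<^sup>n\<^sup>)(R\<^sup>2)\<close> vanishes: the differentiated
  equation shows that \<open>Im (cnj \<phi>\<^sup>(\<^sup>n\<^sup>) \<phi>\<^sup>(\<^sup>n\<^sup>+\<^sup>1\<^sup>))\<close> is multiplied by \<open>c/s\<close> when \<open>n\<close> increases by one, and for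
  \<open>n = 0\<close> it is a Wronskian, which is nonzero. So \<open>u\<close> is orthogonal to all exponentials \<open>exp (b \<bullet> y)\<close>,
  whose span is an algebra that separates points, and Stone-Weierstrass gives \<open>u = 0\<close> almost everywhere.
\<close>

section \<open>Measures on compact sets\<close>

text \<open>Cauchy's inequality turns the bound \<open>g\<close> on the integrand into the bound
  \<open>2 * g y / r\<close> on its \<open>z\<close>-derivative near each point. The difference
  quotients are then dominated by an integrable function, and dominated convergence gives the
  complex derivative of the integral.\<close>

lemma holomorphic_on_lebesgue_integral:
  fixes f :: "complex \<Rightarrow> 'b \<Rightarrow> complex"
  assumes "open U"
    and hol: "\<And>y. y \<in> space M \<Longrightarrow> (\<lambda>z. f z y) holomorphic_on U"
    and meas: "\<And>z. z \<in> U \<Longrightarrow> f z \<in> borel_measurable M"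
    and g: "integrable M g"
    and bound: "\<And>z y. z \<in> U \<Longrightarrow> y \<in> space M \<Longrightarrow> cmod (f z y) \<le> g y"
  shows "(\<lambda>z. \<integral>y. f z y \<partial>M) holomorphic_on U"
  unfolding holomorphic_on_open[OF \<open>open U\<close>]
proof
  fix z0 assume "z0 \<in> U"
  then obtain r where r: "r > 0" "cball z0 r \<subseteq> U"
    using \<open>open U\<close> open_contains_cball by blast
  \<comment> \<open>With half the radius, every \<open>w\<close> in \<open>B\<close> still has a
    disc of radius \<open>r/2\<close> inside \<open>U\<close>, so Cauchy's inequality holds with one
    constant on all of \<open>B\<close>.\<close>
  define B where "B = ball z0 (r/2)"
  have ball_sub: "cball w (r/2) \<subseteq> U" if "w \<in> B" for w
  proof -
    have "cball w (r/2) \<subseteq> cball z0 r"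
      using that by (auto simp: B_def dist_commute cball_subset_cball_iff)
    with r show ?thesis by blast
  qed
  have "z0 \<in> B" "B \<subseteq> U" using r ball_sub by (force simp: B_def)+
  have intf: "integrable M (f z)" if "z \<in> U" for z
    using bound[OF that] by (intro Bochner_Integration.integrable_bound[OF g meas[OF that]] AE_I2) force
  have deriv_bound: "cmod (deriv (\<lambda>z. f z y) w) \<le> 2 * g y / r" if "w \<in> B" "y \<in> space M" for w y
  proof -
    have "cmod ((deriv ^^ 1) (\<lambda>z. f z y) w) \<le> fact 1 * g y / (r/2) ^ 1"
    proof (rule Cauchy_inequality)
      show "(\<lambda>z. f z y) holomorphic_on ball w (r/2)"
        using holomorphic_on_subset[OF hol[OF that(2)]] ball_sub[OF that(1)] ball_subset_cball by blast
      show "continuous_on (cball w (r/2)) (\<lambda>z. f z y)"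
        using continuous_on_subset[OF holomorphic_on_imp_continuous_on[OF hol[OF that(2)]] ball_sub[OF that(1)]] .
      show "cmod (f z y) \<le> g y" if "cmod (w - z) = r/2" for z
      proof -
        have "z \<in> cball w (r/2)" using that by (simp add: dist_norm)
        thus ?thesis using bound ball_sub[OF \<open>w \<in> B\<close>] \<open>y \<in> space M\<close> by blast
      qed
    qed (use r in auto)
    thus ?thesis by (simp add: mult.commute)
  qed
  have lip: "cmod ((f z y - f z0 y) / (z - z0)) \<le> 2 * g y / r" if "z \<in> B" "z \<noteq> z0" "y \<in> space M" for z y
  proof -
    have "cmod (f z y - f z0 y) \<le> (2 * g y / r) * cmod (z - z0)"
    proof (rule field_differentiable_bound[where S=B and f' = "\<lambda>w. deriv (\<lambda>z. f z y) w"])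
      show "((\<lambda>z. f z y) has_field_derivative deriv (\<lambda>z. f z y) w) (at w within B)" if "w \<in> B" for w
        using holomorphic_derivI[OF hol[OF \<open>y \<in> space M\<close>] \<open>open U\<close>] that \<open>B \<subseteq> U\<close> by blast
    qed (use that \<open>z0 \<in> B\<close> deriv_bound in \<open>auto simp: B_def\<close>)
    thus ?thesis using that by (simp add: norm_divide divide_le_eq)
  qed
  have "((\<lambda>z. ((\<integral>y. f z y \<partial>M) - (\<integral>y. f z0 y \<partial>M)) / (z - z0)) \<longlongrightarrow>
          (\<integral>y. deriv (\<lambda>z. f z y) z0 \<partial>M)) (at z0 within B)"
    unfolding tendsto_at_iff_sequentially
  proof (intro allI impI)
    fix X assume X: "\<forall>i. X i \<in> B - {z0}" "X \<longlonglongrightarrow> z0"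
    have XU: "X i \<in> U" for i using X(1) \<open>B \<subseteq> U\<close> by auto
    define q where "q = (\<lambda>i y. (f (X i) y - f z0 y) / (X i - z0))"
    have q_meas: "q i \<in> borel_measurable M" for i
      unfolding q_def using meas[OF XU[of i]] meas[OF \<open>z0 \<in> U\<close>] by measurable
    have q_lim: "(\<lambda>i. q i y) \<longlonglongrightarrow> deriv (\<lambda>z. f z y) z0" if "y \<in> space M" for y
    proof -
      have "((\<lambda>z. f z y) has_field_derivative deriv (\<lambda>z. f z y) z0) (at z0 within B)"
        using holomorphic_derivI[OF hol[OF \<open>y \<in> space M\<close>] \<open>open U\<close> \<open>z0 \<in> U\<close>] .
      hence "((\<lambda>z. (f z y - f z0 y) / (z - z0)) \<longlongrightarrow> deriv (\<lambda>z. f z y) z0) (at z0 within B)"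
        by (simp add: has_field_derivative_iff)
      thus ?thesis using X unfolding tendsto_at_iff_sequentially q_def comp_def by blast
    qed
    have "(\<lambda>i. \<integral>y. q i y \<partial>M) \<longlonglongrightarrow> (\<integral>y. deriv (\<lambda>z. f z y) z0 \<partial>M)"
    proof (rule integral_dominated_convergence)
      show "integrable M (\<lambda>y. 2 * g y / r)" using g by simp
      show "(\<lambda>y. deriv (\<lambda>z. f z y) z0) \<in> borel_measurable M"
        by (rule borel_measurable_LIMSEQ_metric[OF q_meas q_lim])
      show "AE y in M. cmod (q i y) \<le> 2 * g y / r" for i
        using X(1) lip by (auto simp: q_def)
    qed (use q_meas q_lim in auto)
    moreover have "(\<integral>y. q i y \<partial>M) = ((\<integral>y. f (X i) y \<partial>M) - (\<integral>y. f z0 y \<partial>M)) / (X i - z0)" for i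
      unfolding q_def using intf[OF XU[of i]] intf[OF \<open>z0 \<in> U\<close>] by simp
    ultimately show "((\<lambda>z. ((\<integral>y. f z y \<partial>M) - (\<integral>y. f z0 y \<partial>M)) / (z - z0)) \<circ> X) \<longlonglongrightarrow>
          (\<integral>y. deriv (\<lambda>z. f z y) z0 \<partial>M)"
      by (simp add: comp_def)
  qed
  moreover have "open B" by (simp add: B_def)
  ultimately show "\<exists>D. ((\<lambda>z. \<integral>y. f z y \<partial>M) has_field_derivative D) (at z0)"
    using at_within_open[OF \<open>z0 \<in> B\<close>] by (auto simp: has_field_derivative_iff)
qed

section \<open>From vanishing moments to a vanishing density\<close>

text \<open>A uniform error \<open>d\<close> in the test function moves the integral by at most
  \<open>d\<close> times the L1 norm of \<open>u\<close>. This carries orthogonality from a dense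
  class to its uniform closure.\<close>

lemma uniformly_approximable_integral_eq_0:
  fixes u :: "'a \<Rightarrow> complex" and f :: "'a \<Rightarrow> real"
  assumes u: "integrable M u" and f: "f \<in> borel_measurable M"
    and approx: "\<And>e. e > 0 \<Longrightarrow> \<exists>g \<in> borel_measurable M. (\<forall>y\<in>space M. \<bar>f y - g y\<bar> < e) \<and>
        integrable M (\<lambda>y. u y * of_real (g y)) \<and> (\<integral>y. u y * of_real (g y) \<partial>M) = 0"
  shows "(\<integral>y. u y * of_real (f y) \<partial>M) = 0"
proof (cases "integrable M (\<lambda>y. u y * of_real (f y))")
  case True
  have "cmod (\<integral>y. u y * of_real (f y) \<partial>M) \<le> 0 + e" if "e > 0" for e
  proof -
    define K where "K = (\<integral>y. cmod (u y) \<partial>M)"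
    have "K \<ge> 0" by (simp add: K_def)
    define d where "d = e / (K + 1)"
    have "d > 0" using that \<open>K \<ge> 0\<close> by (simp add: d_def)
    obtain g where g: "g \<in> borel_measurable M" "\<And>y. y \<in> space M \<Longrightarrow> \<bar>f y - g y\<bar> < d"
      "integrable M (\<lambda>y. u y * of_real (g y))" "(\<integral>y. u y * of_real (g y) \<partial>M) = 0"
      using approx[OF \<open>d > 0\<close>] by blast
    have "(\<integral>y. u y * of_real (f y) \<partial>M) = (\<integral>y. u y * of_real (f y) - u y * of_real (g y) \<partial>M)"
      using True g by simp
    also have "cmod \<dots> \<le> (\<integral>y. d * cmod (u y) \<partial>M)"
    proof (rule order_trans[OF integral_norm_bound integral_mono])
      show "cmod (u y * of_real (f y) - u y * of_real (g y)) \<le> d * cmod (u y)" if "y \<in> space M" for y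
      proof -
        have "u y * of_real (f y) - u y * of_real (g y) = u y * of_real (f y - g y)"
          by (simp add: algebra_simps)
        hence "cmod (u y * of_real (f y) - u y * of_real (g y)) = \<bar>f y - g y\<bar> * cmod (u y)"
          by (simp only: norm_mult norm_of_real mult.commute)
        thus ?thesis using less_imp_le[OF g(2)[OF that]] by (simp add: mult_right_mono)
      qed
    qed (use True g u in auto)
    also have "\<dots> = d * K" by (simp add: K_def)
    also have "\<dots> \<le> e" using \<open>K \<ge> 0\<close> that by (simp add: d_def field_simps)
    finally show ?thesis by simp
  qed
  hence "cmod (\<integral>y. u y * of_real (f y) \<partial>M) \<le> 0" by (rule field_le_epsilon)
  thus ?thesis by simp
\<comment> \<open>A product that is not integrable has Bochner integral 0 by convention.\<close>
qed (simp add: not_integrable_integral_eq)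

text \<open>This is the linear span of the exponentials. The coefficient sits inside the generator,
  so scalar multiples are included and \<open>b = 0\<close> yields the constants.\<close>

inductive_set exp_sums :: "('a::real_inner \<Rightarrow> real) set" where
  exp: "(\<lambda>y. c * exp (b \<bullet> y)) \<in> exp_sums"
| add: "f \<in> exp_sums \<Longrightarrow> g \<in> exp_sums \<Longrightarrow> (\<lambda>y. f y + g y) \<in> exp_sums"

lemma exp_sums_mult:
  assumes "f \<in> exp_sums" "g \<in> exp_sums"
  shows "(\<lambda>y. f y * g y) \<in> exp_sums"
  using assms
proof (induction f)
  case (exp c b)
  from exp.prems show ?case
  proof (induction g)
    case (exp c' b')
    have "(\<lambda>y. (c * exp (b \<bullet> y)) * (c' * exp (b' \<bullet> y))) = (\<lambda>y. (c * c') * exp ((b + b') \<bullet> y))"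
      by (simp add: inner_add_left exp_add fun_eq_iff)
    thus ?case using exp_sums.exp by metis
  next
    case (add f g)
    thus ?case using exp_sums.add by (simp add: distrib_left)
  qed
next
  case (add f g)
  thus ?case using exp_sums.add by (simp add: distrib_right)
qed

lemma continuous_on_exp_sums: "f \<in> exp_sums \<Longrightarrow> continuous_on A f"
  by (induction rule: exp_sums.induct) (auto intro!: continuous_intros)

text \<open>Supplies the hypotheses of Stone-Weierstrass. Two points \<open>x\<close> and
  \<open>y\<close> are separated by the exponential in direction \<open>x - y\<close>, whose
  exponents there differ by |x - y|^2.\<close>

lemma function_ring_on_exp_sums:
  fixes K :: "'a::euclidean_space set"
  assumes "compact K"
  shows "function_ring_on exp_sums K"
proof
  fix c :: real
  have "(\<lambda>y::'a. c * exp (0 \<bullet> y)) \<in> exp_sums" by (rule exp_sums.exp)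
  thus "(\<lambda>_::'a. c) \<in> exp_sums" by simp
next
  fix x y :: 'a assume "x \<noteq> y"
  have "(\<lambda>z. 1 * exp ((x - y) \<bullet> z)) \<in> exp_sums" by (rule exp_sums.exp)
  moreover have "(x - y) \<bullet> x \<noteq> (x - y) \<bullet> y"
    using \<open>x \<noteq> y\<close> by (metis eq_iff_diff_eq_0 inner_diff_right inner_eq_zero_iff)
  ultimately show "\<exists>f\<in>exp_sums. f x \<noteq> f y" by (intro bexI[of _ "\<lambda>z. 1 * exp ((x - y) \<bullet> z)"]) auto
qed (use assms continuous_on_exp_sums exp_sums.add exp_sums_mult in auto)

lemma measurable_on_compact_measure:
  fixes f :: "'a::euclidean_space \<Rightarrow> 'b::topological_space"
  assumes "sets M = sets (restrict_space borel K)" "continuous_on K f"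
  shows "f \<in> borel_measurable M"
  using borel_measurable_continuous_on_restrict[OF assms(2)] measurable_cong_sets[OF assms(1) refl] by blast

lemma integrable_mult_continuous:
  fixes u f :: "'a::euclidean_space \<Rightarrow> complex"
  assumes "compact K" "sets M = sets (restrict_space borel K)" "integrable M u" "continuous_on K f"
  shows "integrable M (\<lambda>y. u y * f y)"
proof -
  obtain B where B: "\<And>y. y \<in> K \<Longrightarrow> cmod (f y) \<le> B"
    using compact_imp_bounded[OF compact_continuous_image[OF assms(4,1)]] by (auto simp: bounded_iff)
  have sp: "space M = K" using sets_eq_imp_space_eq[OF assms(2)] by (simp add: space_restrict_space)
  show ?thesis
  proof (rule Bochner_Integration.integrable_bound)
    show "integrable M (\<lambda>y. B *\<^sub>R u y)" using assms(3) by simp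
    show "(\<lambda>y. u y * f y) \<in> borel_measurable M"
      using measurable_on_compact_measure[OF assms(2,4)] borel_measurable_integrable[OF assms(3)] by measurable
    show "AE y in M. norm (u y * f y) \<le> norm (B *\<^sub>R u y)"
    proof (intro AE_I2)
      fix y assume "y \<in> space M"
      hence "cmod (f y) \<le> \<bar>B\<bar>" using B sp by force
      thus "norm (u y * f y) \<le> norm (B *\<^sub>R u y)"
        by (simp add: norm_mult mult.commute mult_right_mono)
    qed
  qed
qed

text \<open>Indicators of closed sets are bounded pointwise limits of continuous functions, so
  \<open>u\<close> integrates to 0 over closed sets. These form an intersection-stable generator of
  the Borel sets, so the same holds over every Borel set by Dynkin's argument, which forces
  \<open>u\<close> to vanish almost everywhere.\<close>

lemma AE_eq_0_if_continuous_integrals_eq_0: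
  fixes u :: "'a::euclidean_space \<Rightarrow> complex"
  assumes "finite_measure M" and K: "compact K" and sets_M: "sets M = sets (restrict_space borel K)"
    and u: "integrable M u"
    and zero: "\<And>f :: 'a \<Rightarrow> real. continuous_on K f \<Longrightarrow> (\<integral>y. u y * of_real (f y) \<partial>M) = 0"
  shows "AE y in M. u y = 0"
proof -
  interpret finite_measure M by fact
  have sp: "space M = K" using sets_eq_imp_space_eq[OF sets_M] by (simp add: space_restrict_space)
  have mem: "K \<inter> A \<in> sets M" if "A \<in> sets borel" for A
    using that sets_M by (auto simp: sets_restrict_space)
  have ind_int: "integrable M (\<lambda>y. indicator A y *\<^sub>R u y)" if "K \<inter> A \<in> sets M" for A
  proof -
    have "integrable M (\<lambda>y. indicator (K \<inter> A) y *\<^sub>R u y)"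
      using integrable_mult_indicator[OF that u] .
    moreover have "indicator (K \<inter> A) y *\<^sub>R u y = indicator A y *\<^sub>R u y" if "y \<in> space M" for y
      using that by (auto simp: indicator_def sp)
    ultimately show ?thesis by (rule iffD1[OF Bochner_Integration.integrable_cong[OF refl], rotated])
  qed
  have closed_zero: "set_lebesgue_integral M C u = 0" if C: "closed C" for C :: "'a set"
  \<comment> \<open>The empty set is treated apart because \<open>infdist y {}\<close> is 0 by
    convention, which would make every \<open>f n\<close> constantly 1.\<close>
  proof (cases "C = {}")
    case False
    \<comment> \<open>\<open>f n\<close> is 1 on \<open>C\<close> and 0 at distance at least
      \<open>1/n\<close> (for positive \<open>n\<close>) from it; as \<open>C\<close> is closed,
      these functions tend pointwise to its indicator.\<close>
    define f where "f = (\<lambda>n y. max 0 (1 - real n * infdist y C))"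
    have cont: "continuous_on K (f n)" for n unfolding f_def by (intro continuous_intros)
    have lim: "(\<lambda>n. u y * complex_of_real (f n y)) \<longlonglongrightarrow> indicator C y *\<^sub>R u y" for y
    proof (cases "y \<in> C")
      case True
      thus ?thesis using False by (simp add: f_def)
    next
      case out: False
      hence "infdist y C > 0" using C False by (simp add: infdist_pos_not_in_closed)
      then obtain n0 :: nat where n0: "real n0 * infdist y C > 1" using reals_Archimedean3 by blast
      have "f n y = 0" if "n \<ge> n0" for n
      proof -
        have "real n * infdist y C \<ge> real n0 * infdist y C" using that by (intro mult_right_mono infdist_nonneg) auto
        thus ?thesis using n0 by (simp add: f_def)
      qed
      hence "\<forall>\<^sub>F n in sequentially. u y * complex_of_real (f n y) = 0"
        unfolding eventually_sequentially by (intro exI[of _ n0]) simp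
      thus ?thesis using out by (simp add: tendsto_eventually)
    qed
    have "(\<lambda>n. \<integral>y. u y * of_real (f n y) \<partial>M) \<longlonglongrightarrow> (\<integral>y. indicator C y *\<^sub>R u y \<partial>M)"
    proof (rule integral_dominated_convergence[where w = "\<lambda>y. cmod (u y)"])
      show "(\<lambda>y. indicator C y *\<^sub>R u y) \<in> borel_measurable M"
        using borel_measurable_integrable[OF ind_int[OF mem[OF borel_closed[OF C]]]] .
      show "(\<lambda>y. u y * of_real (f n y)) \<in> borel_measurable M" for n
        using measurable_on_compact_measure[OF sets_M cont] borel_measurable_integrable[OF u] by measurable
      show "AE y in M. cmod (u y * of_real (f n y)) \<le> cmod (u y)" for n
      proof (intro AE_I2)
        fix y
        have "\<bar>f n y\<bar> \<le> 1" by (auto simp: f_def max_def infdist_nonneg)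
        thus "cmod (u y * of_real (f n y)) \<le> cmod (u y)" by (simp add: norm_mult mult_left_le)
      qed
    qed (use u lim in auto)
    hence "(\<integral>y. indicator C y *\<^sub>R u y \<partial>M) = 0"
      by (simp add: zero[OF cont] LIMSEQ_const_iff)
    thus ?thesis by (simp add: set_lebesgue_integral_def)
  qed (simp add: set_lebesgue_integral_def)
  have int_stable: "Int_stable (Collect closed :: 'a set set)" by (auto simp: Int_stable_def)
  have subset_Pow: "Collect closed \<subseteq> Pow (UNIV :: 'a set)" by simp
  have borel_zero: "(\<integral>y. indicator A y *\<^sub>R u y \<partial>M) = 0" if "A \<in> sigma_sets UNIV (Collect closed)" for A
    using int_stable subset_Pow that
  proof (induction A rule: sigma_sets_induct_disjoint)
    case (basic A)
    thus ?case using closed_zero by (simp add: set_lebesgue_integral_def)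
  next
    case empty
    show ?case by simp
  next
    case (compl A)
    hence "A \<in> sets borel" by (simp add: borel_eq_closed)
    have "(\<lambda>y. indicator (UNIV - A) y *\<^sub>R u y) = (\<lambda>y. indicator UNIV y *\<^sub>R u y - indicator A y *\<^sub>R u y)"
      by (auto simp: indicator_def)
    moreover have "(\<integral>y. indicator UNIV y *\<^sub>R u y \<partial>M) = 0"
      using closed_zero[of UNIV] by (simp add: set_lebesgue_integral_def)
    ultimately show ?case
      using compl ind_int[OF mem[OF \<open>A \<in> sets borel\<close>]] u by simp
  next
    case (union A)
    have Ab: "A i \<in> sets borel" for i using union by (auto simp: borel_eq_closed)
    \<comment> \<open>Countable additivity is applied to the traces \<open>K \<inter> A i\<close>,
      since the measurable sets of \<open>M\<close> are subsets of \<open>K\<close>.\<close>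
    have "set_lebesgue_integral M (\<Union>i. K \<inter> A i) u = (\<Sum>i. set_lebesgue_integral M (K \<inter> A i) u)"
    proof (rule lebesgue_integral_countable_add)
      show "set_integrable M (\<Union>i. K \<inter> A i) u"
        unfolding set_integrable_def by (rule integrable_mult_indicator) (use mem Ab u in auto)
      show "(K \<inter> A i) \<inter> (K \<inter> A j) = {}" if "i \<noteq> j" for i j
        using that union(1) unfolding disjoint_family_on_def by blast
    qed (use mem Ab in auto)
    moreover have "set_lebesgue_integral M (K \<inter> A i) u = (\<integral>y. indicator (A i) y *\<^sub>R u y \<partial>M)" for i
      unfolding set_lebesgue_integral_def by (rule Bochner_Integration.integral_cong) (auto simp: sp indicator_def)
    moreover have "set_lebesgue_integral M (\<Union>i. K \<inter> A i) u = (\<integral>y. indicator (\<Union>i. A i) y *\<^sub>R u y \<partial>M)"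
      unfolding set_lebesgue_integral_def by (rule Bochner_Integration.integral_cong) (auto simp: sp indicator_def)
    ultimately show ?case using union by simp
  qed
  show ?thesis
  proof (rule density_zero[OF u])
    fix A assume "A \<in> sets M"
    then obtain A' where A': "A' \<in> sets borel" "A = K \<inter> A'" using sets_M by (auto simp: sets_restrict_space)
    have "set_lebesgue_integral M A u = (\<integral>y. indicator A' y *\<^sub>R u y \<partial>M)"
      unfolding set_lebesgue_integral_def A' by (rule Bochner_Integration.integral_cong) (auto simp: sp indicator_def)
    thus "set_lebesgue_integral M A u = 0" using borel_zero A' by (simp add: borel_eq_closed)
  qed
qed

text \<open>Integrating the exponential series term by term makes \<open>u\<close> orthogonal to
  every exponential; Stone-Weierstrass extends this to all continuous functions on \<open>K\<close>,
  and the preceding criterion applies.\<close>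

lemma AE_eq_0_if_moments_eq_0:
  fixes u :: "'a::euclidean_space \<Rightarrow> complex"
  assumes "finite_measure M" and K: "compact K" and sets_M: "sets M = sets (restrict_space borel K)"
    and u: "integrable M u"
    and moments: "\<And>b n. (\<integral>y. u y * of_real (b \<bullet> y) ^ n \<partial>M) = 0"
  shows "AE y in M. u y = 0"
proof (rule AE_eq_0_if_continuous_integrals_eq_0[OF assms(1-4)])
  have sp: "space M = K" using sets_eq_imp_space_eq[OF sets_M] by (simp add: space_restrict_space)
  have int: "integrable M (\<lambda>y. u y * of_real (f y))" if "continuous_on K f" for f :: "'a \<Rightarrow> real"
    by (intro integrable_mult_continuous[OF K sets_M u] continuous_intros that)
  have exp_zero: "(\<integral>y. u y * of_real (exp (b \<bullet> y)) \<partial>M) = 0" for b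
  proof -
    obtain L where L: "\<And>y. y \<in> K \<Longrightarrow> norm y \<le> L" using compact_imp_bounded[OF K] by (auto simp: bounded_iff)
    \<comment> \<open>Bounds the terms of the series by |u| times those of a convergent exponential
      series, as termwise integration requires. The absolute value guards against a negative
      \<open>L\<close>, possible when \<open>K\<close> is empty.\<close>
    have bd: "cmod (u y * of_real (b \<bullet> y) ^ n / fact n) \<le> cmod (u y) * ((norm b * \<bar>L\<bar>) ^ n / fact n)" if "y \<in> K" for y n
    proof -
      have "\<bar>b \<bullet> y\<bar> \<le> norm b * norm y" by (rule Cauchy_Schwarz_ineq2)
      also have "\<dots> \<le> norm b * \<bar>L\<bar>" using L[OF that] by (intro mult_left_mono) auto
      finally have "\<bar>b \<bullet> y\<bar> ^ n \<le> (norm b * \<bar>L\<bar>) ^ n" by (intro power_mono) auto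
      thus ?thesis
        by (simp add: norm_mult norm_divide norm_power divide_right_mono mult_left_mono)
    qed
    have summ: "summable (\<lambda>n. (norm b * \<bar>L\<bar>) ^ n / fact n)"
      using summable_exp[of "norm b * \<bar>L\<bar>"] by (simp add: field_simps)
    have int_n: "integrable M (\<lambda>y. u y * of_real (b \<bullet> y) ^ n / fact n)" for n
    proof -
      have "integrable M (\<lambda>y. u y * of_real ((b \<bullet> y) ^ n / fact n))"
        by (intro int continuous_intros) auto
      thus ?thesis by simp
    qed
    have "(\<lambda>n. \<integral>y. u y * of_real (b \<bullet> y) ^ n / fact n \<partial>M) sums
       (\<integral>y. (\<Sum>n. u y * of_real (b \<bullet> y) ^ n / fact n) \<partial>M)"
    proof (rule sums_integral)
      show "AE y in M. summable (\<lambda>n. norm (u y * of_real (b \<bullet> y) ^ n / fact n))"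
      proof (intro AE_I2)
        fix y assume "y \<in> space M"
        thus "summable (\<lambda>n. norm (u y * of_real (b \<bullet> y) ^ n / fact n))"
          using bd sp by (intro summable_comparison_test'[OF summable_mult[OF summ, of "cmod (u y)"]]) auto
      qed
      have "norm (\<integral>y. norm (u y * of_real (b \<bullet> y) ^ n / fact n) \<partial>M)
          \<le> (\<integral>y. cmod (u y) \<partial>M) * ((norm b * \<bar>L\<bar>) ^ n / fact n)" for n
      proof -
        have "(\<integral>y. norm (u y * of_real (b \<bullet> y) ^ n / fact n) \<partial>M) \<le>
           (\<integral>y. cmod (u y) * ((norm b * \<bar>L\<bar>) ^ n / fact n) \<partial>M)"
          using int_n u bd sp by (intro integral_mono) auto
        thus ?thesis by simp
      qed
      thus "summable (\<lambda>n. \<integral>y. norm (u y * of_real (b \<bullet> y) ^ n / fact n) \<partial>M)"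
        by (intro summable_comparison_test'[OF summable_mult[OF summ, of "\<integral>y. cmod (u y) \<partial>M"]])
    qed (use int_n in auto)
    moreover have "(\<Sum>n. u y * of_real (b \<bullet> y) ^ n / fact n) = u y * of_real (exp (b \<bullet> y))" for y
    proof -
      have "(\<lambda>n. u y * (of_real (b \<bullet> y) ^ n /\<^sub>R fact n)) sums (u y * exp (of_real (b \<bullet> y)))"
        by (intro sums_mult exp_converges)
      thus ?thesis by (simp add: sums_iff exp_of_real scaleR_conv_of_real divide_inverse mult_ac)
    qed
    moreover have "(\<integral>y. u y * of_real (b \<bullet> y) ^ n / fact n \<partial>M) = 0" for n
      using moments[of b n] by simp
    ultimately show ?thesis by (simp add: sums_iff)
  qed
  have exp_sums_zero: "(\<integral>y. u y * of_real (g y) \<partial>M) = 0" if "g \<in> exp_sums" for g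
    using that
  proof (induction)
    case (exp c b)
    have "(\<lambda>y. u y * of_real (c * exp (b \<bullet> y))) = (\<lambda>y. of_real c * (u y * of_real (exp (b \<bullet> y))))"
      by (simp add: mult_ac)
    thus ?case using exp_zero[of b] by simp
  next
    case (add f g)
    thus ?case using int[OF continuous_on_exp_sums] by (simp add: distrib_left)
  qed
  fix f :: "'a \<Rightarrow> real" assume f: "continuous_on K f"
  show "(\<integral>y. u y * of_real (f y) \<partial>M) = 0"
  proof (rule uniformly_approximable_integral_eq_0[OF u measurable_on_compact_measure[OF sets_M f]])
    fix e :: real assume "e > 0"
    then obtain g where g: "g \<in> exp_sums" "\<forall>y\<in>K. \<bar>f y - g y\<bar> < e"
      using function_ring_on.Stone_Weierstrass_basic[OF function_ring_on_exp_sums[OF K] f] by blast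
    thus "\<exists>g\<in>borel_measurable M. (\<forall>y\<in>space M. \<bar>f y - g y\<bar> < e) \<and>
        integrable M (\<lambda>y. u y * of_real (g y)) \<and> (\<integral>y. u y * of_real (g y) \<partial>M) = 0"
      using int[OF continuous_on_exp_sums] exp_sums_zero sp
        measurable_on_compact_measure[OF sets_M continuous_on_exp_sums] by blast
  qed
qed

section \<open>Potentials of densities on a sphere\<close>

text \<open>Serves to show that the domain of the analytic continuation below is convex, hence
  connected.\<close>

lemma convex_Collect_norm_affine_less:
  fixes f :: "'a::real_vector \<Rightarrow> 'b::real_normed_vector"
  assumes "linear f"
  shows "convex {z. norm (a + f z) < c}"
proof (rule convexI)
  fix x y and p q :: real
  assume *: "x \<in> {z. norm (a + f z) < c}" "y \<in> {z. norm (a + f z) < c}" "0 \<le> p" "0 \<le> q" "p + q = 1"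
  interpret linear f by fact
  have "a + f (p *\<^sub>R x + q *\<^sub>R y) = p *\<^sub>R (a + f x) + q *\<^sub>R (a + f y)"
    using scaleR_left_distrib[of p q a] * by (simp add: add scale algebra_simps)
  also have "norm \<dots> \<le> p * norm (a + f x) + q * norm (a + f y)"
    using * by (intro order_trans[OF norm_triangle_ineq]) simp
  also have "\<dots> < c" using * by (intro convex_bound_lt) auto
  finally show "p *\<^sub>R x + q *\<^sub>R y \<in> {z. norm (a + f z) < c}" by simp
qed

text \<open>Join \<open>x\<close> to a point \<open>x0\<close> of \<open>\<Omega>\<close> by a
  segment. The squared distance to \<open>y\<close> is a quadratic polynomial in the segment
  parameter; for complex parameters near [0,1] its values stay in the right half-plane, because the
  segment stays away from the sphere. The potential is thus holomorphic in the parameter, vanishes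
  near \<open>x0\<close>, and by the identity theorem vanishes at \<open>x\<close>.\<close>

lemma sphere_potential_continuation:
  fixes u :: "'a::euclidean_space \<Rightarrow> complex"
  assumes sets_M: "sets M = sets (restrict_space borel (sphere 0 R))"
    and u: "integrable M u"
    and hol: "\<phi> holomorphic_on {s. 0 < Re s}"
    and \<Omega>: "open \<Omega>" "\<Omega> \<noteq> {}" "\<Omega> \<subseteq> ball 0 R"
    and zero: "\<And>x. x \<in> \<Omega> \<Longrightarrow> (\<integral>y. u y * \<phi> (of_real ((dist x y)\<^sup>2)) \<partial>M) = 0"
    and x: "x \<in> ball 0 R"
  shows "(\<integral>y. u y * \<phi> (of_real ((dist x y)\<^sup>2)) \<partial>M) = 0"
proof -
  define K where "K = sphere (0::'a) R"
  have sp: "space M = K" using sets_eq_imp_space_eq[OF sets_M] by (simp add: space_restrict_space K_def)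
  obtain x0 where x0: "x0 \<in> \<Omega>" using \<Omega> by auto
  obtain \<eta> where \<eta>: "\<eta> > 0" "ball x0 \<eta> \<subseteq> \<Omega>" using \<Omega>(1) x0 open_contains_ball by blast
  define d where "d = x - x0"
  define P where "P = (\<lambda>z. x0 + Re z *\<^sub>R d)"
  \<comment> \<open>For real \<open>z\<close> this is the squared distance from
    \<open>x0 + z d\<close> to \<open>y\<close>; as a polynomial it makes sense for complex
    \<open>z\<close>. \<open>P\<close> follows only the real part of \<open>z\<close>.\<close>
  define s where "s = (\<lambda>(z::complex) y. of_real ((norm (x0 - y))\<^sup>2) + 2 * z * of_real ((x0 - y) \<bullet> d) + z\<^sup>2 * of_real ((norm d)\<^sup>2))"
  \<comment> \<open>The smaller distance of the two endpoints from the sphere.\<close>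
  define \<delta> where "\<delta> = min (R - norm x0) (R - norm x)"
  have "norm x0 < R" "norm x < R" using x x0 \<Omega>(3) by auto
  hence \<delta>: "\<delta> > 0" "\<delta> \<le> R" "norm x0 \<le> R - \<delta>" "norm x \<le> R - \<delta>"
    unfolding \<delta>_def by (auto simp: min_def intro: order_trans[OF _ norm_ge_zero])
  \<comment> \<open>The first condition keeps \<open>P z\<close> at distance more than
    \<open>\<delta>/2\<close> from the sphere, the second keeps |Im z| |d| below
    \<open>\<delta>/4\<close>. Hence Re s is at least \<open>\<delta>\<close>^2/4 -
    \<open>\<delta>\<close>^2/16, the constant in \<open>D\<close> below. The summand
    \<open>0 +\<close> fits the form of the convexity lemma.\<close>
  define U where "U = {z. norm (x0 + Re z *\<^sub>R d) < R - \<delta>/2} \<inter> {z. norm (0 + Im z * norm d) < \<delta>/4}"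
  have "linear (\<lambda>z. Re z *\<^sub>R d)" "linear (\<lambda>z. Im z * norm d)"
    by (auto intro!: linearI simp: algebra_simps)
  hence "convex U" unfolding U_def by (intro convex_Int convex_Collect_norm_affine_less)
  have "open U" unfolding U_def
    by (intro open_Int open_Collect_less continuous_intros)
  have "0 \<in> U" "1 \<in> U" using \<delta> by (auto simp: U_def d_def)

  have P_sq: "(norm (P z - y))\<^sup>2 = (norm (x0 - y))\<^sup>2 + 2 * Re z * ((x0 - y) \<bullet> d) + (Re z)\<^sup>2 * (norm d)\<^sup>2" for z y
  proof -
    have "P z - y = (x0 - y) + Re z *\<^sub>R d" by (simp add: P_def)
    thus ?thesis unfolding power2_norm_eq_inner
      by (simp add: inner_add_left inner_add_right inner_commute power2_eq_square algebra_simps)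
  qed
  have s_eq: "s z y = Complex ((norm (P z - y))\<^sup>2 - (Im z * norm d)\<^sup>2) (2 * Im z * ((P z - y) \<bullet> d))" for z y
  proof (rule complex_eqI)
    show "Re (s z y) = Re (Complex ((norm (P z - y))\<^sup>2 - (Im z * norm d)\<^sup>2) (2 * Im z * ((P z - y) \<bullet> d)))"
      by (simp add: s_def P_sq[unfolded power2_eq_square] power2_eq_square algebra_simps)
    have "(P z - y) \<bullet> d = (x0 - y) \<bullet> d + Re z * (norm d)\<^sup>2"
      by (simp add: P_def inner_diff_left inner_add_left power2_norm_eq_inner)
    thus "Im (s z y) = Im (Complex ((norm (P z - y))\<^sup>2 - (Im z * norm d)\<^sup>2) (2 * Im z * ((P z - y) \<bullet> d)))"
      by (simp add: s_def power2_eq_square algebra_simps)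
  qed
  \<comment> \<open>A compact part of the half-plane containing all values \<open>s z y\<close>, so
    \<open>\<phi>\<close> is bounded there and a multiple of |u| dominates the integrand. The radius
    comes from |s| \<le> (r + q)^2 with r \<le> 2R and q \<le> R.\<close>
  define D where "D = {s. 3 * \<delta>\<^sup>2 / 16 \<le> Re s} \<inter> cball 0 (9 * R\<^sup>2)"
  have "compact D" unfolding D_def
    by (intro closed_Int_compact closed_Collect_le continuous_intros compact_cball)
  have D_sub: "D \<subseteq> {s. 0 < Re s}"
  proof
    fix s assume "s \<in> D"
    hence "3 * \<delta>\<^sup>2 / 16 \<le> Re s" by (simp add: D_def)
    moreover have "3 * \<delta>\<^sup>2 / 16 > 0" using \<delta> by simp
    ultimately have "0 < Re s" by linarith
    thus "s \<in> {s. 0 < Re s}" by simp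
  qed
  have "compact (\<phi> ` D)"
    by (intro compact_continuous_image holomorphic_on_imp_continuous_on holomorphic_on_subset[OF hol D_sub]
        \<open>compact D\<close>)
  from compact_imp_bounded[OF this] obtain C where "\<forall>w\<in>\<phi> ` D. cmod w \<le> C"
    unfolding bounded_iff by blast
  hence C: "cmod (\<phi> s) \<le> C" if "s \<in> D" for s using that by blast
  have s_D: "s z y \<in> D" if "z \<in> U" "y \<in> K" for z y
  proof -
    define r q where "r = norm (P z - y)" and "q = \<bar>Im z\<bar> * norm d"
    have "norm (P z) < R - \<delta>/2" "norm y = R" using that by (auto simp: U_def P_def K_def)
    hence r: "r \<ge> \<delta>/2" "r \<le> 2 * R"
      using norm_triangle_ineq3[of "P z" y] norm_triangle_ineq4[of "P z" y] \<delta> by (auto simp: r_def)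
    have q: "0 \<le> q" "q \<le> \<delta>/4" using that by (auto simp: U_def q_def abs_mult)
    have "(\<delta>/2)\<^sup>2 \<le> r\<^sup>2" "q\<^sup>2 \<le> (\<delta>/4)\<^sup>2" using r q \<delta> by (auto intro: power_mono)
    moreover have "Re (s z y) = r\<^sup>2 - q\<^sup>2" by (simp add: s_eq r_def q_def power_mult_distrib)
    ultimately have "3 * \<delta>\<^sup>2 / 16 \<le> Re (s z y)" by (simp add: power2_eq_square)
    moreover have "cmod (s z y) \<le> 9 * R\<^sup>2"
    proof -
      have "\<bar>Im (s z y)\<bar> = 2 * \<bar>Im z\<bar> * \<bar>(P z - y) \<bullet> d\<bar>" by (simp add: s_eq abs_mult)
      also have "\<dots> \<le> 2 * \<bar>Im z\<bar> * (r * norm d)"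
        unfolding r_def by (intro mult_left_mono Cauchy_Schwarz_ineq2) auto
      finally have "\<bar>Im (s z y)\<bar> \<le> 2 * q * r" by (simp add: q_def mult_ac)
      moreover have "\<bar>Re (s z y)\<bar> \<le> r\<^sup>2 + q\<^sup>2" using \<open>Re (s z y) = r\<^sup>2 - q\<^sup>2\<close> by (simp add: abs_le_iff)
      ultimately have "cmod (s z y) \<le> (r + q)\<^sup>2"
        using cmod_le[of "s z y"] by (simp add: power2_sum algebra_simps)
      also have "\<dots> \<le> (3 * R)\<^sup>2" using r q \<delta> by (intro power_mono) auto
      finally show ?thesis by (simp add: power2_eq_square)
    qed
    ultimately show ?thesis by (simp add: D_def)
  qed
  define F where "F = (\<lambda>z. \<integral>y. u y * \<phi> (s z y) \<partial>M)"
  have F_hol: "F holomorphic_on U" unfolding F_def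
  proof (rule holomorphic_on_lebesgue_integral[OF \<open>open U\<close>, where g = "\<lambda>y. C * cmod (u y)"])
    fix y assume "y \<in> space M"
    hence "(\<lambda>z. s z y) ` U \<subseteq> {s. 0 < Re s}" using s_D D_sub sp by auto
    moreover have "(\<lambda>z. s z y) holomorphic_on U" unfolding s_def by (intro holomorphic_intros)
    ultimately have "(\<lambda>z. \<phi> (s z y)) holomorphic_on U"
      using holomorphic_on_compose_gen[OF _ hol] by (auto simp: o_def)
    thus "(\<lambda>z. u y * \<phi> (s z y)) holomorphic_on U" by (intro holomorphic_intros)
  next
    fix z assume "z \<in> U"
    have "continuous_on K (\<lambda>y. \<phi> (s z y))"
    proof (rule continuous_on_compose2[OF holomorphic_on_imp_continuous_on[OF hol]])
      show "continuous_on K (s z)" unfolding s_def by (intro continuous_intros)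
      show "s z ` K \<subseteq> {s. 0 < Re s}" using s_D[OF \<open>z \<in> U\<close>] D_sub by auto
    qed
    from measurable_on_compact_measure[OF sets_M this[unfolded K_def]]
    show "(\<lambda>y. u y * \<phi> (s z y)) \<in> borel_measurable M"
      using borel_measurable_integrable[OF u] by measurable
    show "cmod (u y * \<phi> (s z y)) \<le> C * cmod (u y)" if "y \<in> space M" for y
      using mult_left_mono[OF C[OF s_D[OF \<open>z \<in> U\<close>]] norm_ge_zero[of "u y"]] that sp
      by (simp add: norm_mult mult.commute)
  qed (use u in simp)
  \<comment> \<open>For small real t > 0 the point \<open>P t\<close> still lies in
    \<open>\<Omega>\<close>, so the zeros of \<open>F\<close> accumulate at 0.\<close>
  have F_lim: "0 islimpt {z \<in> U. F z = 0}"
    unfolding islimpt_approachable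
  proof (intro allI impI)
    fix e :: real assume "e > 0"
    obtain r where r: "r > 0" "ball 0 r \<subseteq> U" using \<open>open U\<close> \<open>0 \<in> U\<close> open_contains_ball by blast
    have "0 < \<eta> / (norm d + 1)" using \<eta> by (intro divide_pos_pos add_nonneg_pos) auto
    then obtain t where t: "0 < t" "t < e" "t < r" "t < \<eta> / (norm d + 1)"
      using dense[of 0 "min (min e r) (\<eta> / (norm d + 1))"] r \<open>e > 0\<close> by auto
    have "t * norm d \<le> t * (norm d + 1)" using t by simp
    also have "\<dots> < \<eta>" using t(4) by (simp add: pos_less_divide_eq add_nonneg_pos)
    finally have "P t \<in> \<Omega>" using \<eta> t by (auto simp: P_def dist_norm)
    have "s t y = of_real ((dist (P t) y)\<^sup>2)" for y
      by (simp add: s_eq dist_norm complex_of_real_def)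
    hence "F t = 0" using zero[OF \<open>P t \<in> \<Omega>\<close>] by (simp add: F_def)
    moreover have "of_real t \<in> U" using r t by auto
    ultimately show "\<exists>z\<in>{z \<in> U. F z = 0}. z \<noteq> 0 \<and> dist z 0 < e"
      using t by (intro bexI[of _ "of_real t"]) auto
  qed
  have "F 1 = 0"
    by (rule analytic_continuation[where U = "{z \<in> U. F z = 0}",
          OF F_hol \<open>open U\<close> convex_connected[OF \<open>convex U\<close>] _ \<open>0 \<in> U\<close> F_lim _ \<open>1 \<in> U\<close>])
      simp_all
  moreover have "s 1 y = of_real ((dist x y)\<^sup>2)" for y
    by (simp add: s_eq dist_norm complex_of_real_def P_def d_def)
  ultimately show ?thesis by (simp add: F_def)
qed

text \<open>Strong induction on \<open>n\<close>. Once the lower moments vanish, the Taylor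
  expansion of order \<open>n\<close> at R^2 leaves only \<open>a n * (-2) ^ n * I n\<close> times
  t^n, up to a remainder of order t^(n+1). Dividing by t^n and letting t tend to 0 kills this
  coefficient, and \<open>a n\<close> is nonzero.\<close>

lemma sphere_moments_eq_0:
  fixes u :: "'a::euclidean_space \<Rightarrow> complex"
  assumes sets_M: "sets M = sets (restrict_space borel (sphere 0 R))" and "R > 0"
    and u: "integrable M u"
    and hol: "\<phi> holomorphic_on {s. 0 < Re s}"
    and deriv_nz: "\<And>n. (deriv ^^ n) \<phi> (of_real (R\<^sup>2)) \<noteq> 0"
    and zero: "\<And>x. x \<in> ball 0 R \<Longrightarrow> (\<integral>y. u y * \<phi> (of_real ((dist x y)\<^sup>2)) \<partial>M) = 0"
  shows "(\<integral>y. u y * of_real (b \<bullet> y) ^ n \<partial>M) = 0"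
proof (induction n rule: less_induct)
  case (less n)
  define K where "K = sphere (0::'a) R"
  have "compact K" by (simp add: K_def)
  have sets_M': "sets M = sets (restrict_space borel K)" using sets_M by (simp add: K_def)
  have sp: "space M = K" using sets_eq_imp_space_eq[OF sets_M'] by (simp add: space_restrict_space)
  have int: "integrable M (\<lambda>y. u y * f y)" if "continuous_on K f" for f
    by (rule integrable_mult_continuous[OF \<open>compact K\<close> sets_M' u that])
  \<comment> \<open>A compact disc around the expansion point inside the half-plane, on which the
    next derivative is bounded.\<close>
  define S where "S = cball (complex_of_real (R\<^sup>2)) (R\<^sup>2 / 2)"
  define H where "H = {s. 0 < Re s}"
  have "open H" unfolding H_def by (rule open_halfspace_Re_gt)
  have "S \<subseteq> H"
  proof
    fix s assume "s \<in> S"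
    hence "\<bar>Re (of_real (R\<^sup>2) - s)\<bar> \<le> R\<^sup>2 / 2"
      using abs_Re_le_cmod[of "of_real (R\<^sup>2) - s"] by (simp add: S_def dist_norm)
    hence "R\<^sup>2 - Re s \<le> R\<^sup>2 / 2" using abs_ge_self[of "Re (of_real (R\<^sup>2) - s)"] by simp
    moreover have "R\<^sup>2 > 0" using \<open>R > 0\<close> by simp
    ultimately have "0 < Re s" by linarith
    thus "s \<in> H" by (simp add: H_def)
  qed
  have holn: "(deriv ^^ i) \<phi> holomorphic_on H" for i
    by (rule holomorphic_higher_deriv) (use hol \<open>open H\<close> in \<open>auto simp: H_def\<close>)
  have center_S: "of_real (R\<^sup>2) \<in> S" by (simp add: S_def)
  have "compact ((deriv ^^ Suc n) \<phi> ` S)"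
    by (intro compact_continuous_image continuous_on_subset[OF holomorphic_on_imp_continuous_on[OF holn] \<open>S \<subseteq> H\<close>])
      (simp add: S_def)
  from compact_imp_bounded[OF this] obtain B where "\<forall>w\<in>(deriv ^^ Suc n) \<phi> ` S. cmod w \<le> B"
    unfolding bounded_iff by blast
  hence B: "cmod ((deriv ^^ Suc n) \<phi> s) \<le> B" if "s \<in> S" for s using that by blast
  have "B \<ge> 0" using order_trans[OF norm_ge_zero B[OF center_S]] .
  define I where "I = (\<lambda>j. \<integral>y. u y * of_real (b \<bullet> y) ^ j \<partial>M)"
  define a where "a = (\<lambda>i. (deriv ^^ i) \<phi> (of_real (R\<^sup>2)) / fact i)"
  \<comment> \<open>Bounds |t |b|^2 - 2 b.y| for 0 < t \<le> 1 and |y| = R. The summand 1 keeps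
    \<open>C\<close> positive when \<open>b = 0\<close>, since \<open>t0\<close> below divides by
    it.\<close>
  define C where "C = (norm b)\<^sup>2 + 2 * norm b * R + 1"
  have "C > 0" using \<open>R > 0\<close> by (auto simp: C_def intro!: add_nonneg_pos)
  define L where "L = (\<integral>y. cmod (u y) \<partial>M)"
  have key: "cmod (a n * (-2) ^ n * I n) \<le> (B * C ^ Suc n / fact n * L) * t"
    if t: "0 < t" "t \<le> 1" "t * C \<le> R\<^sup>2 / 2" for t
  proof -
    \<comment> \<open>On the sphere \<open>h y\<close> is |tb - y|^2 - R^2; it has size
      O(t).\<close>
    define h where "h = (\<lambda>y. t * (t * (norm b)\<^sup>2 - 2 * (b \<bullet> y)))"
    have h_bound: "\<bar>h y\<bar> \<le> t * C" if "y \<in> K" for y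
    proof -
      have "\<bar>b \<bullet> y\<bar> \<le> norm b * R" using Cauchy_Schwarz_ineq2[of b y] that by (simp add: K_def)
      moreover have "\<bar>t * (norm b)\<^sup>2\<bar> \<le> (norm b)\<^sup>2" using t by (simp add: abs_mult mult_left_le_one_le)
      ultimately have "\<bar>t * (norm b)\<^sup>2 - 2 * (b \<bullet> y)\<bar> \<le> C" unfolding C_def abs_le_iff by linarith
      thus ?thesis unfolding h_def abs_mult using t by (simp add: mult_left_mono)
    qed
    have cont_h: "continuous_on K h" unfolding h_def by (intro continuous_intros)
    have dist_eq: "(dist (t *\<^sub>R b) y)\<^sup>2 = R\<^sup>2 + h y" if "y \<in> K" for y
    proof -
      have "(dist (t *\<^sub>R b) y)\<^sup>2 = t\<^sup>2 * (norm b)\<^sup>2 - 2 * t * (b \<bullet> y) + (norm y)\<^sup>2"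
        unfolding dist_norm power2_norm_eq_inner
        by (simp add: inner_diff_left inner_diff_right inner_commute power2_eq_square algebra_simps)
      thus ?thesis using that by (simp add: K_def h_def power2_eq_square algebra_simps)
    qed
    have in_S: "of_real (R\<^sup>2 + h y) \<in> S" if "y \<in> K" for y
      using h_bound[OF that] t(3) by (simp add: S_def dist_norm)
    have taylor: "cmod (\<phi> (of_real (R\<^sup>2 + h y)) - (\<Sum>i\<le>n. a i * of_real (h y) ^ i)) \<le> B * (t * C) ^ Suc n / fact n"
      if "y \<in> K" for y
    proof -
      have "cmod ((deriv ^^ 0) \<phi> (of_real (R\<^sup>2 + h y)) - (\<Sum>i\<le>n. (deriv ^^ i) \<phi> (of_real (R\<^sup>2)) *
          (of_real (R\<^sup>2 + h y) - of_real (R\<^sup>2)) ^ i / fact i))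
        \<le> B * cmod (of_real (R\<^sup>2 + h y) - of_real (R\<^sup>2)) ^ Suc n / fact n"
      proof (rule complex_Taylor[where S = S and f = "\<lambda>i. (deriv ^^ i) \<phi>"])
        show "((deriv ^^ i) \<phi> has_field_derivative (deriv ^^ Suc i) \<phi> s) (at s within S)" if "s \<in> S" for i s
          using holomorphic_derivI[OF holn \<open>open H\<close>] that \<open>S \<subseteq> H\<close> by auto
      qed (use B in_S[OF that] center_S in \<open>auto simp: S_def\<close>)
      moreover have "complex_of_real (R\<^sup>2 + h y) - of_real (R\<^sup>2) = of_real (h y)" by simp
      ultimately have "cmod (\<phi> (of_real (R\<^sup>2 + h y)) - (\<Sum>i\<le>n. a i * of_real (h y) ^ i))
         \<le> B * \<bar>h y\<bar> ^ Suc n / fact n"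
        by (simp only: norm_of_real) (simp add: a_def)
      also have "\<dots> \<le> B * (t * C) ^ Suc n / fact n"
        using h_bound[OF that] \<open>B \<ge> 0\<close> by (intro divide_right_mono mult_left_mono power_mono) auto
      finally show ?thesis .
    qed
    have cont_phi: "continuous_on K (\<lambda>y. \<phi> (of_real (R\<^sup>2 + h y)))"
    proof (rule continuous_on_compose2[OF holomorphic_on_imp_continuous_on[OF hol]])
      show "continuous_on K (\<lambda>y. complex_of_real (R\<^sup>2 + h y))" by (intro continuous_intros cont_h)
      show "(\<lambda>y. complex_of_real (R\<^sup>2 + h y)) ` K \<subseteq> {s. 0 < Re s}"
        using in_S \<open>S \<subseteq> H\<close> unfolding H_def by blast
    qed
    have cont_sum: "continuous_on K (\<lambda>y. \<Sum>i\<le>n. a i * of_real (h y) ^ i)"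
      by (intro continuous_intros cont_h)
    \<comment> \<open>The smallness condition on \<open>t * C\<close> also gives t |b| \<le> R/4,
      because \<open>C\<close> contains the summand \<open>2 * norm b * R\<close>.\<close>
    have "t *\<^sub>R b \<in> ball 0 R"
    proof -
      have "t * (2 * norm b * R) \<le> t * C" unfolding C_def using t by (intro mult_left_mono) auto
      hence "(t * norm b) * R \<le> (R / 4) * R" using t(3) by (simp add: power2_eq_square algebra_simps)
      hence "t * norm b \<le> R / 4" using \<open>R > 0\<close> by simp
      hence "t * norm b < R" using \<open>R > 0\<close> by linarith
      thus ?thesis using t by simp
    qed
    from zero[OF this] have zero': "(\<integral>y. u y * \<phi> (of_real (R\<^sup>2 + h y)) \<partial>M) = 0"
      using Bochner_Integration.integral_cong[OF refl, of M "\<lambda>y. u y * \<phi> (of_real ((dist (t *\<^sub>R b) y)\<^sup>2))"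
        "\<lambda>y. u y * \<phi> (of_real (R\<^sup>2 + h y))"] dist_eq sp by simp
    \<comment> \<open>By the binomial theorem \<open>h y ^ i\<close> involves only powers (b.y)^j
      with j \<le> i \<le> n. Those with j < n integrate to 0 by induction, so only i = j = n
      survives.\<close>
    have h_moment: "(\<integral>y. u y * of_real (h y) ^ i \<partial>M) = (if i = n then of_real t ^ n * ((-2) ^ n * I n) else 0)"
      if "i \<le> n" for i
    proof -
      have "u y * of_real (h y) ^ i = (\<Sum>j\<le>i. (of_real t ^ i * of_nat (i choose j) * (-2) ^ j *
          of_real (t * (norm b)\<^sup>2) ^ (i - j)) * (u y * of_real (b \<bullet> y) ^ j))" for y
      proof -
        have "complex_of_real (h y) = of_real t * ((-2) * of_real (b \<bullet> y) + of_real (t * (norm b)\<^sup>2))"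
          by (simp add: h_def)
        thus ?thesis
          by (simp only: power_mult_distrib binomial_ring sum_distrib_left mult_ac)
      qed
      hence "(\<integral>y. u y * of_real (h y) ^ i \<partial>M) = (\<integral>y. (\<Sum>j\<le>i. (of_real t ^ i * of_nat (i choose j) * (-2) ^ j *
          of_real (t * (norm b)\<^sup>2) ^ (i - j)) * (u y * of_real (b \<bullet> y) ^ j)) \<partial>M)" by simp
      also have "\<dots> = (\<Sum>j\<le>i. (of_real t ^ i * of_nat (i choose j) * (-2) ^ j *
          of_real (t * (norm b)\<^sup>2) ^ (i - j)) * I j)"
      proof -
        have "integrable M (\<lambda>y. u y * of_real (b \<bullet> y) ^ j)" for j
          by (intro int continuous_intros)
        thus ?thesis unfolding I_def
          by (subst Bochner_Integration.integral_sum) auto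
      qed
      also have "\<dots> = (\<Sum>j\<le>i. if j = n then of_real t ^ n * ((-2) ^ n * I n) else 0)"
      proof (rule sum.cong)
        fix j assume "j \<in> {..i}"
        show "of_real t ^ i * of_nat (i choose j) * (-2) ^ j * of_real (t * (norm b)\<^sup>2) ^ (i - j) * I j
          = (if j = n then of_real t ^ n * ((-2) ^ n * I n) else 0)"
        proof (cases "j = n")
          case True
          thus ?thesis using \<open>j \<in> {..i}\<close> \<open>i \<le> n\<close> by simp
        next
          case False
          hence "I j = 0" using less \<open>j \<in> {..i}\<close> \<open>i \<le> n\<close> unfolding I_def by simp
          thus ?thesis using False by simp
        qed
      qed simp
      also have "\<dots> = (if i = n then of_real t ^ n * ((-2) ^ n * I n) else 0)"
        using that by (auto simp: sum.delta)
      finally show ?thesis .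
    qed
    have "(\<integral>y. u y * (\<Sum>i\<le>n. a i * of_real (h y) ^ i) \<partial>M) = (\<integral>y. (\<Sum>i\<le>n. a i * (u y * of_real (h y) ^ i)) \<partial>M)"
      by (simp add: sum_distrib_left mult_ac)
    also have "\<dots> = (\<Sum>i\<le>n. a i * (\<integral>y. u y * of_real (h y) ^ i \<partial>M))"
    proof -
      have "integrable M (\<lambda>y. u y * of_real (h y) ^ i)" for i
        by (intro int continuous_intros cont_h)
      thus ?thesis by (subst Bochner_Integration.integral_sum) auto
    qed
    also have "\<dots> = (\<Sum>i\<le>n. if i = n then a n * (of_real t ^ n * ((-2) ^ n * I n)) else 0)"
      by (intro sum.cong) (use h_moment in auto)
    also have "\<dots> = a n * (of_real t ^ n * ((-2) ^ n * I n))" by simp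
    finally have sum_int: "(\<integral>y. u y * (\<Sum>i\<le>n. a i * of_real (h y) ^ i) \<partial>M) = a n * (of_real t ^ n * ((-2) ^ n * I n))" .
    have "- (a n * (of_real t ^ n * ((-2) ^ n * I n))) =
      (\<integral>y. u y * (\<phi> (of_real (R\<^sup>2 + h y)) - (\<Sum>i\<le>n. a i * of_real (h y) ^ i)) \<partial>M)"
      unfolding right_diff_distrib
      by (subst Bochner_Integration.integral_diff[OF int[OF cont_phi] int[OF cont_sum]]) (simp only: zero' sum_int diff_0)
    from arg_cong[OF this, of cmod]
    have "cmod (a n * (of_real t ^ n * ((-2) ^ n * I n))) =
      cmod (\<integral>y. u y * (\<phi> (of_real (R\<^sup>2 + h y)) - (\<Sum>i\<le>n. a i * of_real (h y) ^ i)) \<partial>M)"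
      by (simp only: norm_minus_cancel)
    also have "\<dots> \<le> (\<integral>y. cmod (u y) * (B * (t * C) ^ Suc n / fact n) \<partial>M)"
    proof (rule order_trans[OF integral_norm_bound integral_mono])
      show "integrable M (\<lambda>y. cmod (u y * (\<phi> (of_real (R\<^sup>2 + h y)) - (\<Sum>i\<le>n. a i * of_real (h y) ^ i))))"
        by (intro integrable_norm int continuous_on_diff cont_phi cont_sum)
      show "integrable M (\<lambda>y. cmod (u y) * (B * (t * C) ^ Suc n / fact n))" using u by simp
      show "cmod (u y * (\<phi> (of_real (R\<^sup>2 + h y)) - (\<Sum>i\<le>n. a i * of_real (h y) ^ i)))
         \<le> cmod (u y) * (B * (t * C) ^ Suc n / fact n)" if "y \<in> space M" for y
        unfolding norm_mult using taylor that sp by (intro mult_left_mono) auto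
    qed
    also have "\<dots> = t ^ n * ((B * C ^ Suc n / fact n * L) * t)"
      by (simp add: L_def power_mult_distrib)
    finally have "t ^ n * cmod (a n * (-2) ^ n * I n) \<le> t ^ n * ((B * C ^ Suc n / fact n * L) * t)"
      using t by (simp add: norm_mult norm_power mult_ac)
    thus ?thesis by (rule mult_left_le_imp_le) (use t in simp)
  qed
  have "((\<lambda>t. (B * C ^ Suc n / fact n * L) * t) \<longlongrightarrow> (B * C ^ Suc n / fact n * L) * 0) (at_right 0)"
    by (intro tendsto_intros)
  moreover have "eventually (\<lambda>t. cmod (a n * (-2) ^ n * I n) \<le> (B * C ^ Suc n / fact n * L) * t) (at_right 0)"
  proof -
    define t0 where "t0 = min 1 (R\<^sup>2 / 2 / C)"
    have "t0 > 0" using \<open>R > 0\<close> \<open>C > 0\<close> by (simp add: t0_def)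
    have "cmod (a n * (-2) ^ n * I n) \<le> (B * C ^ Suc n / fact n * L) * t" if "t \<in> {0<..<t0}" for t
      by (rule key) (use that \<open>C > 0\<close> in \<open>auto simp: t0_def pos_less_divide_eq\<close>)
    thus ?thesis unfolding eventually_at_right_field using \<open>t0 > 0\<close> by auto
  qed
  ultimately have "cmod (a n * (-2) ^ n * I n) \<le> (B * C ^ Suc n / fact n * L) * 0"
    by (rule tendsto_lowerbound) simp
  hence "a n * (-2) ^ n * I n = 0" by simp
  thus ?case using deriv_nz[of n] by (simp add: a_def I_def del: of_real_power)
qed

section \<open>The radial profile of the Green function\<close>

text \<open>Differentiating the equation \<open>n\<close> times replaces \<open>a\<close> by
  \<open>a + n\<close> and keeps \<open>c\<close>. At the real point \<open>x\<close>, multiply by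
  the conjugate of the derivative of order \<open>n + 1\<close> and take imaginary parts: the middle
  term is real and drops out. So the \<open>n\<close>-th Wronskian-type quantity, times c/x, gives
  the next one and never becomes 0.\<close>

lemma higher_deriv_nonzero_of_ode:
  fixes f f' f'' :: "complex \<Rightarrow> complex" and a c x :: real
  assumes "open H" and "complex_of_real x \<in> H"
    and f': "\<And>s. s \<in> H \<Longrightarrow> (f has_field_derivative f' s) (at s)"
    and f'': "\<And>s. s \<in> H \<Longrightarrow> (f' has_field_derivative f'' s) (at s)"
    and ode: "\<And>s. s \<in> H \<Longrightarrow> s * f'' s + of_real a * f' s + of_real c * f s = 0"
    and "x \<noteq> 0" "c \<noteq> 0"
    and wronskian: "Im (cnj (f x) * f' x) \<noteq> 0"
  shows "(deriv ^^ n) f x \<noteq> 0"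
proof -
  have hol: "f holomorphic_on H" using f' holomorphic_on_open[OF \<open>open H\<close>] by blast
  have D: "((deriv ^^ n) f has_field_derivative (deriv ^^ Suc n) f s) (at s)" if "s \<in> H" for n s
    using holomorphic_derivI[OF holomorphic_higher_deriv[OF hol \<open>open H\<close>] \<open>open H\<close> that] by simp
  have d1: "deriv f s = f' s" if "s \<in> H" for s using f'[OF that] DERIV_imp_deriv by blast
  have d2: "deriv (deriv f) s = f'' s" if "s \<in> H" for s
  proof -
    have "deriv (deriv f) s = deriv f' s"
      by (rule deriv_cong_ev) (use eventually_nhds_in_open[OF \<open>open H\<close> that] d1 in \<open>auto elim: eventually_mono\<close>)
    thus ?thesis using f''[OF that] DERIV_imp_deriv by simp
  qed
  have ode_n: "\<forall>s\<in>H. s * (deriv ^^ Suc (Suc n)) f s + of_real (a + n) * (deriv ^^ Suc n) f s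
      + of_real c * (deriv ^^ n) f s = 0" for n
  proof (induction n)
    case 0
    thus ?case using ode d1 d2 by simp
  next
    case (Suc n)
    show ?case
    proof
      fix s assume "s \<in> H"
      let ?L = "\<lambda>s. s * (deriv ^^ Suc (Suc n)) f s + of_real (a + n) * (deriv ^^ Suc n) f s
        + of_real c * (deriv ^^ n) f s"
      have "(?L has_field_derivative (1 * (deriv ^^ Suc (Suc n)) f s + (deriv ^^ Suc (Suc (Suc n))) f s * s)
         + of_real (a + n) * (deriv ^^ Suc (Suc n)) f s + of_real c * (deriv ^^ Suc n) f s) (at s)"
        by (intro DERIV_add DERIV_mult DERIV_cmult DERIV_ident D \<open>s \<in> H\<close>)
      moreover have "(?L has_field_derivative 0) (at s)"
      proof -
        have "((\<lambda>_. 0 :: complex) has_field_derivative 0) (at s)" by simp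
        thus ?thesis
          using has_field_derivative_transform_within_open[of "\<lambda>_. 0" 0 s H ?L] \<open>open H\<close> \<open>s \<in> H\<close> Suc by auto
      qed
      ultimately have "(1 * (deriv ^^ Suc (Suc n)) f s + (deriv ^^ Suc (Suc (Suc n))) f s * s)
         + of_real (a + n) * (deriv ^^ Suc (Suc n)) f s + of_real c * (deriv ^^ Suc n) f s = 0"
        using DERIV_unique by blast
      thus "s * (deriv ^^ Suc (Suc (Suc n))) f s + of_real (a + Suc n) * (deriv ^^ Suc (Suc n)) f s
        + of_real c * (deriv ^^ Suc n) f s = 0"
        by (simp add: algebra_simps del: funpow.simps)
    qed
  qed
  have "Im (cnj ((deriv ^^ n) f x) * (deriv ^^ Suc n) f x) \<noteq> 0"
  proof (induction n)
    case 0
    thus ?case using wronskian d1 \<open>of_real x \<in> H\<close> by simp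
  next
    case (Suc n)
    define p q w where "p = (deriv ^^ n) f x" "q = (deriv ^^ Suc n) f x" "w = (deriv ^^ Suc (Suc n)) f x"
    have "of_real x * w + of_real (a + n) * q + of_real c * p = 0"
      using ode_n \<open>of_real x \<in> H\<close> unfolding p_q_w_def by blast
    hence "of_real x * w = - of_real (a + n) * q - of_real c * p"
      by (metis add_diff_cancel_right' diff_0 minus_mult_left add.assoc add_eq_0_iff diff_minus_eq_add uminus_add_conv_diff)
    hence "Im (cnj q * (of_real x * w)) = Im (cnj q * (- of_real (a + n) * q - of_real c * p))" by simp
    hence "x * Im (cnj q * w) = c * Im (cnj p * q)"
      by (simp add: algebra_simps)
    thus ?case using Suc \<open>c \<noteq> 0\<close> \<open>x \<noteq> 0\<close> unfolding p_q_w_def[symmetric] by auto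
  qed
  thus ?thesis by force
qed

section \<open>Entire power series for the Bessel functions of order zero\<close>

lemma fps_conv_radius_infinite:
  fixes F :: "complex fps"
  assumes "\<And>m. cmod (fps_nth F m) \<le> 1 / fact m"
  shows "fps_conv_radius F = \<infinity>"
  unfolding fps_conv_radius_def
proof (rule conv_radius_inftyI'')
  fix z :: complex
  show "summable (\<lambda>m. fps_nth F m * z ^ m)"
  proof (rule summable_comparison_test')
    show "summable (\<lambda>m. inverse (fact m) * cmod z ^ m)" by (rule summable_exp)
    show "norm (fps_nth F m * z ^ m) \<le> inverse (fact m) * cmod z ^ m" for m
      using assms[of m] by (simp add: norm_mult norm_power mult_right_mono divide_inverse)
  qed
qed

text \<open>The power series \<open>J\<close> and \<open>Y\<close> of the expansions in the variable \<open>v = (z/2)\<^sup>2\<close>: \<open>J\<^sub>0(z) = J(v)\<close> and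
  \<open>Y\<^sub>0(z) = 2/\<pi> ((ln v / 2 + \<gamma>) J(v) + Y(v))\<close>. In this variable Bessel's equation reads \<open>v f'' + f' + f = 0\<close>.\<close>

definition J0_fps :: "complex fps" where
  "J0_fps = Abs_fps (\<lambda>m. (-1) ^ m / (fact m)\<^sup>2)"

definition Y0_fps :: "complex fps" where
  "Y0_fps = Abs_fps (\<lambda>m. - ((-1) ^ m * of_real (harm m) / (fact m)\<^sup>2))"

lemma harm_le_fact: "harm m \<le> (fact m :: real)"
proof -
  have "harm m \<le> (\<Sum>k=1..m. 1::real)" unfolding harm_def by (intro sum_mono) (auto simp: field_simps)
  also have "\<dots> \<le> fact m" using of_nat_mono[OF fact_ge_self[of m], where ?'a = real] by simp
  finally show ?thesis .
qed

lemma fps_conv_radius_J0: "fps_conv_radius J0_fps = \<infinity>"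
proof (rule fps_conv_radius_infinite)
  fix m
  have "1 / (fact m)\<^sup>2 \<le> (fact m / (fact m)\<^sup>2 :: real)"
    by (intro divide_right_mono fact_ge_1) auto
  also have "\<dots> = 1 / fact m" by (simp add: power2_eq_square)
  finally show "cmod (fps_nth J0_fps m) \<le> 1 / fact m"
    by (simp add: J0_fps_def norm_divide norm_power norm_mult)
qed

lemma fps_conv_radius_Y0: "fps_conv_radius Y0_fps = \<infinity>"
proof (rule fps_conv_radius_infinite)
  fix m
  have "harm m / (fact m)\<^sup>2 \<le> (fact m / (fact m)\<^sup>2 :: real)"
    by (intro divide_right_mono harm_le_fact) auto
  also have "\<dots> = 1 / fact m" by (simp add: power2_eq_square)
  finally show "cmod (fps_nth Y0_fps m) \<le> 1 / fact m"
    by (simp add: Y0_fps_def norm_divide norm_power norm_mult harm_nonneg)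
qed

text \<open>The operator v f'' + f' sends v^(m+1) to (m+1)^2 v^m, so Bessel's equation becomes a
  two-term recurrence for the coefficients.\<close>

lemma fps_nth_bessel_operator:
  "fps_nth (fps_X * fps_deriv (fps_deriv F) + fps_deriv F) m = (of_nat (Suc m))\<^sup>2 * fps_nth F (Suc m)"
  for F :: "complex fps"
  by (cases m) (simp_all add: power2_eq_square algebra_simps)

lemma Suc_sq_div_fact_sq: "(of_nat (Suc m))\<^sup>2 * (x / (fact (Suc m))\<^sup>2) = x / (fact m :: complex)\<^sup>2"
proof -
  have "(of_nat (Suc m) :: complex) \<noteq> 0" by (simp del: of_nat_Suc)
  thus ?thesis by (simp add: power_mult_distrib del: of_nat_Suc)
qed

lemma J0_fps_recurrence: "(of_nat (Suc m))\<^sup>2 * fps_nth J0_fps (Suc m) = - fps_nth J0_fps m"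
  unfolding J0_fps_def fps_nth_Abs_fps Suc_sq_div_fact_sq by simp

lemma J0_fps_ode: "fps_X * fps_deriv (fps_deriv J0_fps) + fps_deriv J0_fps + J0_fps = 0"
proof (rule fps_ext)
  fix m
  show "fps_nth (fps_X * fps_deriv (fps_deriv J0_fps) + fps_deriv J0_fps + J0_fps) m = fps_nth 0 m"
    unfolding fps_add_nth[of "_ + _" J0_fps] fps_nth_bessel_operator J0_fps_recurrence by simp
qed

text \<open>Inserting (ln v / 2) J + Y into Bessel's equation, the derivatives of the logarithm
  leave exactly one extra term J', which Y has to compensate. On coefficients this is the relation
  \<open>harm (Suc m) = harm m + 1 / (m + 1)\<close>.\<close>

lemma Y0_fps_ode:
  "fps_X * fps_deriv (fps_deriv Y0_fps) + fps_deriv Y0_fps + Y0_fps + fps_deriv J0_fps = 0"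
proof (rule fps_ext)
  fix m
  define a :: complex where "a = (-1) ^ m / (fact m)\<^sup>2"
  have nz: "(of_nat (Suc m) :: complex) \<noteq> 0" by (simp del: of_nat_Suc)
  have "(of_nat (Suc m))\<^sup>2 * fps_nth Y0_fps (Suc m) = a * of_real (harm (Suc m))"
    unfolding Y0_fps_def fps_nth_Abs_fps mult_minus_right Suc_sq_div_fact_sq by (simp add: a_def)
  also have "complex_of_real (harm (Suc m)) = of_real (harm m) + inverse (of_nat (Suc m))"
    by (simp add: harm_Suc)
  also have "a * \<dots> = a * of_real (harm m) + a * inverse (of_nat (Suc m))" by (rule distrib_left)
  finally have 1: "(of_nat (Suc m))\<^sup>2 * fps_nth Y0_fps (Suc m) = a * of_real (harm m) + a * inverse (of_nat (Suc m))" .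
  have 2: "fps_nth (fps_deriv J0_fps) m = - (a * inverse (of_nat (Suc m)))"
  proof -
    have "of_nat (Suc m) * fps_nth (fps_deriv J0_fps) m = (of_nat (Suc m))\<^sup>2 * fps_nth J0_fps (Suc m)"
      unfolding fps_deriv_nth power2_eq_square by (simp only: mult.assoc Suc_eq_plus1)
    also have "\<dots> = - a" unfolding J0_fps_recurrence by (simp add: J0_fps_def a_def)
    finally have "inverse (of_nat (Suc m)) * (of_nat (Suc m) * fps_nth (fps_deriv J0_fps) m)
      = inverse (of_nat (Suc m)) * (- a)" by (rule arg_cong)
    thus ?thesis unfolding mult.assoc[symmetric] left_inverse[OF nz] by simp
  qed
  have cancel: "x + y + - x + - y = 0" for x y :: complex by simp
  have 3: "fps_nth Y0_fps m = - (a * of_real (harm m))" by (simp add: Y0_fps_def a_def)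
  show "fps_nth (fps_X * fps_deriv (fps_deriv Y0_fps) + fps_deriv Y0_fps + Y0_fps + fps_deriv J0_fps) m
    = fps_nth 0 m"
    unfolding fps_add_nth[of "_ + _" "fps_deriv J0_fps"] fps_add_nth[of "_ + _" Y0_fps] fps_nth_bessel_operator
      1 2 3 fps_zero_nth by (rule cancel)
qed

lemma real_fps_eval:
  fixes F :: "complex fps"
  assumes "fps_conv_radius F = \<infinity>" and c: "\<And>n. fps_nth F n = of_real (c n)"
  shows "(\<lambda>n. c n * x ^ n) sums Re (eval_fps F (of_real x))"
    and "Im (eval_fps F (of_real x)) = 0"
proof -
  have "(\<lambda>n. fps_nth F n * of_real x ^ n) sums eval_fps F (of_real x)"
    by (rule sums_eval_fps) (simp add: assms)
  hence "(\<lambda>n. complex_of_real (c n * x ^ n)) sums eval_fps F (of_real x)" by (simp add: c)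
  from sums_Re[OF this] sums_Im[OF this]
  show "(\<lambda>n. c n * x ^ n) sums Re (eval_fps F (of_real x))" "Im (eval_fps F (of_real x)) = 0"
    by (simp_all add: sums_iff)
qed

lemma J0_fps_real: "fps_nth J0_fps n = of_real ((-1) ^ n / (fact n)\<^sup>2)"
  by (simp add: J0_fps_def)

lemma Y0_fps_real: "fps_nth Y0_fps n = of_real (- ((-1) ^ n * harm n / (fact n)\<^sup>2))"
  by (simp add: Y0_fps_def)

lemma bessel_J0_eq: "bessel_J0 z = Re (eval_fps J0_fps (of_real ((z / 2)\<^sup>2)))"
proof -
  have "(-1) ^ n / (fact n)\<^sup>2 * ((z / 2)\<^sup>2) ^ n = (-1) ^ n * (z / 2) ^ (2 * n) / (fact n)\<^sup>2" for n
    unfolding power_mult by simp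
  with real_fps_eval(1)[OF fps_conv_radius_J0 J0_fps_real, of "(z / 2)\<^sup>2"]
  show ?thesis unfolding bessel_J0_def by (simp only: sums_iff)
qed

lemma bessel_Y0_eq:
  "bessel_Y0 z = 2 / pi * ((ln (z / 2) + euler_mascheroni) * Re (eval_fps J0_fps (of_real ((z / 2)\<^sup>2)))
     + Re (eval_fps Y0_fps (of_real ((z / 2)\<^sup>2))))"
proof -
  have "(\<lambda>n. - ((-1) ^ n * harm n / (fact n)\<^sup>2) * ((z / 2)\<^sup>2) ^ n)
      sums Re (eval_fps Y0_fps (of_real ((z / 2)\<^sup>2)))"
    by (rule real_fps_eval(1)[OF fps_conv_radius_Y0 Y0_fps_real])
  \<comment> \<open>The series in \<open>bessel_Y0\<close> starts at degree one; the shift is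
    harmless because \<open>harm 0 = 0\<close> makes the term of degree zero vanish.\<close>
  hence "(\<lambda>n. - ((-1) ^ Suc n * harm (Suc n) / (fact (Suc n))\<^sup>2) * ((z / 2)\<^sup>2) ^ Suc n)
      sums Re (eval_fps Y0_fps (of_real ((z / 2)\<^sup>2)))"
    by (subst sums_Suc_iff) (simp add: harm_def)
  moreover have "- ((-1) ^ Suc n * harm (Suc n) / (fact (Suc n))\<^sup>2) * ((z / 2)\<^sup>2) ^ Suc n
     = (-1) ^ n * harm (Suc n) * (z / 2) ^ (2 * Suc n) / (fact (Suc n))\<^sup>2" for n
    unfolding power_mult by simp
  ultimately have "(\<lambda>n. (-1) ^ n * harm (Suc n) * (z / 2) ^ (2 * Suc n) / (fact (Suc n))\<^sup>2)
      sums Re (eval_fps Y0_fps (of_real ((z / 2)\<^sup>2)))" by (simp only:)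
  note Y = conjunct2[OF this[unfolded sums_iff]]
  show ?thesis unfolding bessel_Y0_def bessel_J0_eq Y by (simp only: ring_distribs mult.assoc)
qed

lemma eval_fps_ode:
  fixes F G :: "complex fps"
  assumes "fps_conv_radius F = \<infinity>" "fps_conv_radius G = \<infinity>"
    and "fps_X * fps_deriv (fps_deriv F) + fps_deriv F + F + G = 0"
  shows "v * eval_fps (fps_deriv (fps_deriv F)) v + eval_fps (fps_deriv F) v + eval_fps F v + eval_fps G v = 0"
proof -
  have r: "fps_conv_radius (fps_deriv F) = \<infinity>" "fps_conv_radius (fps_deriv (fps_deriv F)) = \<infinity>"
    using fps_conv_radius_deriv[of F] fps_conv_radius_deriv[of "fps_deriv F"] assms(1) by auto
  have r2: "fps_conv_radius (A + B) = \<infinity>" "fps_conv_radius (A * B) = \<infinity>"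
    if "fps_conv_radius A = \<infinity>" "fps_conv_radius B = \<infinity>" for A B :: "complex fps"
    using fps_conv_radius_add[of A B] fps_conv_radius_mult[of A B] that by auto
  have "eval_fps (fps_X * fps_deriv (fps_deriv F) + fps_deriv F + F + G) v
    = v * eval_fps (fps_deriv (fps_deriv F)) v + eval_fps (fps_deriv F) v + eval_fps F v + eval_fps G v"
    using assms(1,2) r by (simp add: eval_fps_add eval_fps_mult r2)
  thus ?thesis by (simp add: assms(3))
qed

lemma DERIV_eval_fps:
  fixes F :: "complex fps"
  assumes "fps_conv_radius F = \<infinity>"
  shows "(eval_fps F has_field_derivative eval_fps (fps_deriv F) v) (at v)"
  by (rule has_field_derivative_eval_fps) (simp add: assms)

text \<open>Up to a constant factor this is \<open>v\<close> times the Wronskian of \<open>J\<^sub>0\<close> and \<open>Y\<^sub>0\<close> in the variable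
  \<open>v\<close>; the logarithms cancel, which makes it entire, so its constant value can be read off at \<open>v = 0\<close>.\<close>

lemma bessel_wronskian:
  fixes v :: complex
  shows "(eval_fps J0_fps v)\<^sup>2 + 2 * v * (eval_fps J0_fps v * eval_fps (fps_deriv Y0_fps) v
      - eval_fps (fps_deriv J0_fps) v * eval_fps Y0_fps v) = 1" (is "?g v = 1")
proof -
  define J J1 J2 T T1 T2 where "J = eval_fps J0_fps" and "J1 = eval_fps (fps_deriv J0_fps)"
    and "J2 = eval_fps (fps_deriv (fps_deriv J0_fps))" and "T = eval_fps Y0_fps"
    and "T1 = eval_fps (fps_deriv Y0_fps)" and "T2 = eval_fps (fps_deriv (fps_deriv Y0_fps))"
  note defs = this
  have r: "fps_conv_radius (fps_deriv J0_fps) = \<infinity>" "fps_conv_radius (fps_deriv Y0_fps) = \<infinity>"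
    using fps_conv_radius_deriv[of J0_fps] fps_conv_radius_deriv[of Y0_fps]
      fps_conv_radius_J0 fps_conv_radius_Y0 by auto
  have D: "(J has_field_derivative J1 z) (at z)" "(J1 has_field_derivative J2 z) (at z)"
     "(T has_field_derivative T1 z) (at z)" "(T1 has_field_derivative T2 z) (at z)" for z
    unfolding defs by (intro DERIV_eval_fps fps_conv_radius_J0 fps_conv_radius_Y0 r)+
  have odeJ: "z * J2 z + J1 z + J z = 0" for z
    using eval_fps_ode[of J0_fps 0 z] J0_fps_ode fps_conv_radius_J0 by (simp add: defs)
  have odeT: "z * T2 z + T1 z + T z + J1 z = 0" for z
    using eval_fps_ode[OF fps_conv_radius_Y0 r(1) Y0_fps_ode] by (simp add: defs)
  have "((\<lambda>z. (J z)\<^sup>2 + 2 * z * (J z * T1 z - J1 z * T z)) has_field_derivative 0) (at z within UNIV)" for z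
  proof -
    have eqs: "z * T2 z = - T1 z - T z - J1 z" "z * J2 z = - J1 z - J z"
      using odeJ[of z] odeT[of z] by (simp_all add: algebra_simps eq_neg_iff_add_eq_0)
    have "2 * (J z * (z * T2 z) - (z * J2 z) * T z) + 2 * (J z * T1 z - J1 z * T z) + 2 * J z * J1 z = 0"
      unfolding eqs by (simp add: algebra_simps)
    thus ?thesis
      by (auto intro!: derivative_eq_intros D simp: power2_eq_square algebra_simps)
  qed
  hence "\<exists>c. \<forall>z\<in>UNIV. (J z)\<^sup>2 + 2 * z * (J z * T1 z - J1 z * T z) = c"
    by (intro has_field_derivative_zero_constant) auto
  then obtain c where c: "\<And>z. (J z)\<^sup>2 + 2 * z * (J z * T1 z - J1 z * T z) = c" by auto
  have "J 0 = 1" by (simp add: defs eval_fps_at_0 J0_fps_def)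
  hence "c = 1" using c[of 0] by simp
  thus ?thesis using c[of v] by (simp add: defs)
qed

section \<open>The Green functions as functions of the squared distance\<close>

text \<open>The conjugate of (i/4)(J_0 + i Y_0) is -(Y_0 + i J_0)/4. With v = k^2 s / 4 it becomes a
  function \<open>X\<close> of \<open>v\<close> solving Bessel's equation in the form v X'' + X' + X
  = 0; rescaling to \<open>s\<close> produces the coefficient k^2/4.\<close>

lemma helmholtz_profile_2d:
  fixes k :: real
  assumes "k > 0" "DIM('a::euclidean_space) = 2"
  obtains f f' f'' :: "complex \<Rightarrow> complex" where
    "\<And>s. 0 < Re s \<Longrightarrow> (f has_field_derivative f' s) (at s)"
    "\<And>s. 0 < Re s \<Longrightarrow> (f' has_field_derivative f'' s) (at s)"
    "\<And>s. 0 < Re s \<Longrightarrow> s * f'' s + of_real 1 * f' s + of_real (k\<^sup>2 / 4) * f s = 0"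
    "\<And>r :: real. r > 0 \<Longrightarrow> Im (cnj (f (complex_of_real r)) * f' (complex_of_real r)) \<noteq> 0"
    "\<And>x y :: 'a. x \<noteq> y \<Longrightarrow> cnj (helmholtz_green k x y) = f (of_real ((dist x y)\<^sup>2))"
proof -
  define J J1 J2 T T1 T2 where "J = eval_fps J0_fps" and "J1 = eval_fps (fps_deriv J0_fps)"
    and "J2 = eval_fps (fps_deriv (fps_deriv J0_fps))" and "T = eval_fps Y0_fps"
    and "T1 = eval_fps (fps_deriv Y0_fps)" and "T2 = eval_fps (fps_deriv (fps_deriv Y0_fps))"
  note defs = this
  have r: "fps_conv_radius (fps_deriv J0_fps) = \<infinity>" "fps_conv_radius (fps_deriv Y0_fps) = \<infinity>"
    using fps_conv_radius_deriv[of J0_fps] fps_conv_radius_deriv[of Y0_fps]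
      fps_conv_radius_J0 fps_conv_radius_Y0 by auto
  have D: "(J has_field_derivative J1 z) (at z)" "(J1 has_field_derivative J2 z) (at z)"
     "(T has_field_derivative T1 z) (at z)" "(T1 has_field_derivative T2 z) (at z)" for z
    unfolding defs by (intro DERIV_eval_fps fps_conv_radius_J0 fps_conv_radius_Y0 r)+
  have odeJ: "z * J2 z + J1 z + J z = 0" for z
    using eval_fps_ode[of J0_fps 0 z] J0_fps_ode fps_conv_radius_J0 by (simp add: defs)
  have odeT: "z * T2 z + T1 z + T z + J1 z = 0" for z
    using eval_fps_ode[OF fps_conv_radius_Y0 r(1) Y0_fps_ode] by (simp add: defs)
  define p where "p = complex_of_real (2 / pi)"
  \<comment> \<open>The principal logarithm is holomorphic for Re v > 0, and half of it at v =
    (z/2)^2 is ln(z/2). \<open>X1\<close> and \<open>X2\<close> are the derivatives of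
    \<open>X\<close>, computed by hand.\<close>
  define l where "l = (\<lambda>v. Ln v / 2 + of_real euler_mascheroni)"
  define X where "X = (\<lambda>v. - (1/4) * (p * (l v * J v + T v) + \<i> * J v))"
  define X1 where "X1 = (\<lambda>v. - (1/4) * (p * (J v / (2 * v) + l v * J1 v + T1 v) + \<i> * J1 v))"
  define X2 where "X2 = (\<lambda>v. - (1/4) * (p * (J1 v / v - J v / (2 * v\<^sup>2) + l v * J2 v + T2 v) + \<i> * J2 v))"
  have Dl: "(l has_field_derivative 1 / (2 * v)) (at v)" if "0 < Re v" for v
    unfolding l_def using that
    by (auto intro!: derivative_eq_intros simp: complex_nonpos_Reals_iff field_simps)
  have DX: "(X has_field_derivative X1 v) (at v)" if "0 < Re v" for v
    unfolding X_def X1_def using that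
    by (auto intro!: derivative_eq_intros D Dl simp: algebra_simps)
  have DX1: "(X1 has_field_derivative X2 v) (at v)" if "0 < Re v" for v
  proof -
    have "v \<noteq> 0" using that by auto
    thus ?thesis unfolding X1_def X2_def using that
      by (auto intro!: derivative_eq_intros D Dl simp: field_simps power2_eq_square)
  qed
  have odeX: "v * X2 v + X1 v + X v = 0" if "0 < Re v" for v
  proof -
    have "v \<noteq> 0" using that by auto
    \<comment> \<open>Grouped so that \<open>l v\<close> multiplies Bessel's expression for
      \<open>J\<close>, the leftover \<open>J1 v\<close> cancels the inhomogeneity in the equation
      for \<open>T\<close>, and the two terms in \<open>J v\<close> cancel each other.\<close>
    have "v * X2 v + X1 v + X v = - (1/4) * (p * ((v * (J1 v / v) + l v * (v * J2 v + J1 v + J v)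
        + (v * T2 v + T1 v + T v)) + (J v / (2 * v) - v * (J v / (2 * v\<^sup>2)))) + \<i> * (v * J2 v + J1 v + J v))"
      unfolding X_def X1_def X2_def by (simp add: algebra_simps)
    also have "v * (J1 v / v) + l v * (v * J2 v + J1 v + J v) + (v * T2 v + T1 v + T v) = 0"
      using odeJ[of v] odeT[of v] \<open>v \<noteq> 0\<close> by (simp add: algebra_simps)
    also have "J v / (2 * v) - v * (J v / (2 * v\<^sup>2)) = 0" using \<open>v \<noteq> 0\<close> by (simp add: power2_eq_square)
    finally show ?thesis by (simp add: odeJ)
  qed
  define c where "c = complex_of_real (k\<^sup>2 / 4)"
  have cRe: "0 < Re (c * s)" if "0 < Re s" for s using that \<open>k > 0\<close> by (simp add: c_def)
  have h1: "((\<lambda>s. X (c * s)) has_field_derivative c * X1 (c * s)) (at s)" if "0 < Re s" for s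
    using DERIV_chain2[OF DX[OF cRe[OF that]] DERIV_cmult_Id[of c s]] by (simp add: mult.commute)
  have h2: "((\<lambda>s. c * X1 (c * s)) has_field_derivative c * (c * X2 (c * s))) (at s)" if "0 < Re s" for s
    using DERIV_cmult[OF DERIV_chain2[OF DX1[OF cRe[OF that]] DERIV_cmult_Id[of c s]], of c]
    by (simp add: mult.commute)
  have h3: "s * (c * (c * X2 (c * s))) + of_real 1 * (c * X1 (c * s)) + of_real (k\<^sup>2 / 4) * X (c * s) = 0"
    if "0 < Re s" for s
  proof -
    have "c * (c * s * X2 (c * s) + X1 (c * s) + X (c * s)) = 0" using odeX[OF cRe[OF that]] by simp
    thus ?thesis unfolding c_def[symmetric] by (simp add: algebra_simps)
  qed
  \<comment> \<open>Real coefficients make all four series real on the real axis, so real and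
    imaginary parts of \<open>X\<close> and \<open>X1\<close> can be read off there.\<close>
  have rJ: "Im (J (of_real v)) = 0" and rT: "Im (T (of_real v)) = 0" for v
    unfolding defs
    using real_fps_eval(2)[OF fps_conv_radius_J0 J0_fps_real] real_fps_eval(2)[OF fps_conv_radius_Y0 Y0_fps_real]
    by blast+
  have rJ1: "Im (J1 (of_real v)) = 0" for v unfolding defs
    by (rule real_fps_eval(2)[OF r(1), of "\<lambda>n. real (n + 1) * ((-1) ^ (n + 1) / (fact (n + 1))\<^sup>2)"])
      (simp only: fps_deriv_nth J0_fps_real of_real_mult of_real_of_nat_eq)
  have rT1: "Im (T1 (of_real v)) = 0" for v unfolding defs
    by (rule real_fps_eval(2)[OF r(2), of "\<lambda>n. real (n + 1) * - ((-1) ^ (n + 1) * harm (n + 1) / (fact (n + 1))\<^sup>2)"])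
      (simp only: fps_deriv_nth Y0_fps_real of_real_mult of_real_of_nat_eq)
  have X_real: "X (of_real v) = Complex (- (2 / pi * ((ln v / 2 + euler_mascheroni) * Re (J v) + Re (T v))) / 4)
      (- Re (J v) / 4)" if "v > 0" for v
    unfolding X_def l_def p_def using that rJ[of v] rT[of v]
    by (intro complex_eqI) (simp_all add: Ln_of_real del: of_real_euler_mascheroni)
  have h4: "Im (cnj (X (c * of_real r)) * (c * X1 (c * of_real r))) \<noteq> 0" if "r > 0" for r :: real
  proof -
    define v where "v = k\<^sup>2 / 4 * r"
    have "v > 0" using that \<open>k > 0\<close> by (simp add: v_def)
    define j j1 t t1 e where "j = Re (J v)" and "j1 = Re (J1 v)" and "t = Re (T v)" and "t1 = Re (T1 v)"
      and "e = ln v / 2 + euler_mascheroni"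
    note reals = this
    have "J v = of_real j" "J1 v = of_real j1" "T v = of_real t" "T1 v = of_real t1"
      using rJ[of v] rJ1[of v] rT[of v] rT1[of v] by (auto simp: reals complex_eq_iff)
    note eqs = this
    have "complex_of_real (j\<^sup>2 + 2 * v * (j * t1 - j1 * t)) = of_real 1"
      using bessel_wronskian[of "of_real v"] unfolding defs[symmetric] eqs by simp
    hence w: "j\<^sup>2 + 2 * v * (j * t1 - j1 * t) = 1" unfolding of_real_eq_iff .
    have X: "X (of_real v) = Complex (- (2 / pi * (e * j + t)) / 4) (- j / 4)"
      using X_real[OF \<open>v > 0\<close>] by (simp add: reals)
    have X1: "X1 (of_real v) = Complex (- (2 / pi * (j / (2 * v) + e * j1 + t1)) / 4) (- j1 / 4)"
    proof -
      have "l (of_real v) = of_real e" using \<open>v > 0\<close> by (simp add: l_def reals Ln_of_real del: of_real_euler_mascheroni)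
      moreover have "J v / (2 * of_real v) = of_real (j / (2 * v))" by (simp add: eqs)
      ultimately show ?thesis unfolding X1_def eqs p_def by (intro complex_eqI) simp_all
    qed
    \<comment> \<open>The logarithmic terms with \<open>e\<close> cancel, and the relation
      \<open>w\<close> reduces the rest to -1/(16 pi v).\<close>
    have "Im (cnj (X v) * X1 v) = - 1 / (8 * pi) * (j * j / (2 * v) + (j * t1 - j1 * t))"
      unfolding X X1 by (simp add: field_simps)
    also have "\<dots> = - 1 / (8 * pi) * ((j\<^sup>2 + 2 * v * (j * t1 - j1 * t)) / (2 * v))"
      using \<open>v > 0\<close> by (simp add: field_simps power2_eq_square)
    also have "\<dots> \<noteq> 0" using w \<open>v > 0\<close> by simp
    finally have nz: "Im (cnj (X v) * X1 v) \<noteq> 0" .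
    have cr: "c * of_real r = of_real v" by (simp add: c_def v_def)
    have "Im (z * (c * w)) = k\<^sup>2 / 4 * Im (z * w)" for z w
      unfolding c_def by (simp add: algebra_simps)
    note Im_scale = this
    have "k\<^sup>2 / 4 \<noteq> 0" using \<open>k > 0\<close> by simp
    thus ?thesis unfolding cr Im_scale using nz by (rule no_zero_divisors)
  qed
  have h5: "cnj (helmholtz_green k x y) = X (c * of_real ((dist x y)\<^sup>2))" if "x \<noteq> y" for x y :: 'a
  proof -
    define z where "z = k * dist x y"
    have "z > 0" using that \<open>k > 0\<close> by (simp add: z_def)
    have cz: "c * of_real ((dist x y)\<^sup>2) = of_real ((z / 2)\<^sup>2)"
      by (simp add: c_def z_def power_mult_distrib power_divide)
    have "ln ((z / 2)\<^sup>2) / 2 = ln (z / 2)" using \<open>z > 0\<close> by (simp add: ln_realpow)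
    moreover have "(z / 2)\<^sup>2 > 0" using \<open>z > 0\<close> by simp
    ultimately have "X (of_real ((z / 2)\<^sup>2)) = Complex (- bessel_Y0 z / 4) (- bessel_J0 z / 4)"
      using X_real[of "(z / 2)\<^sup>2"] unfolding bessel_J0_eq bessel_Y0_eq J_def T_def by simp
    also have "\<dots> = cnj (\<i> / 4 * hankel1_0 z)"
      by (simp add: hankel1_0_def complex_eq_iff)
    finally show ?thesis unfolding cz helmholtz_green_def z_def using assms(2) by simp
  qed
  show thesis by (rule that[of "\<lambda>s. X (c * s)" "\<lambda>s. c * X1 (c * s)" "\<lambda>s. c * (c * X2 (c * s))", OF h1 h2 h3 h4 h5])
qed

text \<open>With r the square root of s, the conjugate Green function is exp(ikr)/(4 pi r). The
  radial Helmholtz equation g'' + (2/r) g' + k^2 g = 0 in r turns into the stated equation in s,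
  with coefficient 3/2.\<close>

lemma helmholtz_profile_3d:
  fixes k :: real
  assumes "k > 0" "DIM('a::euclidean_space) \<noteq> 2"
  obtains f f' f'' :: "complex \<Rightarrow> complex" where
    "\<And>s. 0 < Re s \<Longrightarrow> (f has_field_derivative f' s) (at s)"
    "\<And>s. 0 < Re s \<Longrightarrow> (f' has_field_derivative f'' s) (at s)"
    "\<And>s. 0 < Re s \<Longrightarrow> s * f'' s + of_real (3/2) * f' s + of_real (k\<^sup>2 / 4) * f s = 0"
    "\<And>r :: real. r > 0 \<Longrightarrow> Im (cnj (f (complex_of_real r)) * f' (complex_of_real r)) \<noteq> 0"
    "\<And>x y :: 'a. x \<noteq> y \<Longrightarrow> cnj (helmholtz_green k x y) = f (of_real ((dist x y)\<^sup>2))"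
proof -
  define K where "K = \<i> * complex_of_real k"
  define g where "g = (\<lambda>r. exp (K * r) / (4 * of_real pi * r))"
  \<comment> \<open>\<open>g1\<close> and \<open>g2\<close> are the first two derivatives with
    respect to s = r^2, written in terms of r; since ds/dr = 2r, the r-derivatives below carry a
    factor \<open>2 * r\<close>.\<close>
  define g1 where "g1 = (\<lambda>r. exp (K * r) * (K * r - 1) / (8 * of_real pi * r ^ 3))"
  define g2 where "g2 = (\<lambda>r. exp (K * r) * (K\<^sup>2 * r\<^sup>2 - 3 * K * r + 3) / (16 * of_real pi * r ^ 5))"
  have nz: "csqrt s \<noteq> 0" "s \<notin> \<real>\<^sub>\<le>\<^sub>0" if "0 < Re s" for s
    using that by (auto simp: complex_nonpos_Reals_iff)
  have Dg: "(g has_field_derivative 2 * r * g1 r) (at r)" if "r \<noteq> 0" for r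
    unfolding g_def g1_def using that
    by (auto intro!: derivative_eq_intros simp: field_simps power_numeral_reduce)
  have Dg1: "(g1 has_field_derivative 2 * r * g2 r) (at r)" if "r \<noteq> 0" for r
    unfolding g1_def g2_def using that
    by (auto intro!: derivative_eq_intros simp: field_simps power_numeral_reduce)
  have Dsqrt: "((\<lambda>s. h (csqrt s)) has_field_derivative h' (csqrt s)) (at s)"
    if "0 < Re s" "(h has_field_derivative 2 * csqrt s * h' (csqrt s)) (at (csqrt s))" for h h' s
  proof -
    have "2 * q * d * inverse (2 * q) = d" if "q \<noteq> 0" for q d :: complex
      using that by simp
    note cancel = this[OF nz(1)[OF that(1)]]
    show ?thesis
      using DERIV_chain2[OF that(2) has_field_derivative_csqrt[OF nz(2)[OF that(1)]]] unfolding cancel .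
  qed
  have h1: "((\<lambda>s. g (csqrt s)) has_field_derivative g1 (csqrt s)) (at s)" if "0 < Re s" for s
    by (rule Dsqrt[where h = g and h' = g1, OF that Dg[OF nz(1)[OF that]]])
  have h2: "((\<lambda>s. g1 (csqrt s)) has_field_derivative g2 (csqrt s)) (at s)" if "0 < Re s" for s
    by (rule Dsqrt[where h = g1 and h' = g2, OF that Dg1[OF nz(1)[OF that]]])
  have h3: "s * g2 (csqrt s) + of_real (3/2) * g1 (csqrt s) + of_real (k\<^sup>2 / 4) * g (csqrt s) = 0" if "0 < Re s" for s
  proof -
    define r where "r = csqrt s"
    have "r \<noteq> 0" and sr: "s = r\<^sup>2" using nz[OF that] by (simp_all add: r_def)
    have "of_real (k\<^sup>2) = - K\<^sup>2" by (simp add: K_def power_mult_distrib)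
    hence k: "of_real (k\<^sup>2 / 4) = - K\<^sup>2 / 4" by simp
    have "r\<^sup>2 * g2 r + of_real (3/2) * g1 r + - K\<^sup>2 / 4 * g r = 0"
      unfolding g_def g1_def g2_def using \<open>r \<noteq> 0\<close>
      by (simp add: field_simps power_numeral_reduce)
    thus ?thesis by (simp only: k sr[symmetric] r_def[symmetric])
  qed
  have h4: "Im (cnj (g (csqrt (of_real r))) * g1 (csqrt (of_real r))) \<noteq> 0" if "r > 0" for r :: real
  proof -
    define q where "q = sqrt r"
    have "q > 0" using that by (simp add: q_def)
    \<comment> \<open>For real \<open>q\<close> the exponentials have modulus 1 and cancel. Of the
      remaining factor \<open>K * q - 1\<close> only \<open>K * q\<close> is imaginary, and it is
      nonzero as k, q > 0.\<close>
    have "cnj (exp (K * q)) * exp (K * q) = 1"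
      by (simp add: K_def exp_cnj flip: exp_add)
    hence "cnj (g q) * g1 q = (K * q - 1) / of_real (32 * pi\<^sup>2 * q ^ 4)"
      unfolding g_def g1_def by (simp add: field_simps power_numeral_reduce)
    also have "Im \<dots> = k * q / (32 * pi\<^sup>2 * q ^ 4)"
      by (simp add: K_def Im_divide_of_real)
    also have "\<dots> \<noteq> 0" using \<open>q > 0\<close> \<open>k > 0\<close> by simp
    finally have "Im (cnj (g q) * g1 q) \<noteq> 0" .
    moreover have "csqrt (of_real r) = of_real q" using that by (simp add: q_def)
    ultimately show ?thesis by simp
  qed
  have h5: "cnj (helmholtz_green k x y) = g (csqrt (of_real ((dist x y)\<^sup>2)))" for x y :: 'a
  proof -
    have "csqrt (of_real ((dist x y)\<^sup>2)) = of_real (dist x y)" by simp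
    thus ?thesis using assms(2) unfolding helmholtz_green_def g_def K_def
      by (simp add: exp_cnj mult_ac)
  qed
  show thesis by (rule that[of "\<lambda>s. g (csqrt s)" "\<lambda>s. g1 (csqrt s)" "\<lambda>s. g2 (csqrt s)", OF h1 h2 h3 h4 h5])
qed

text \<open>Merges the two explicit profiles, hiding the coefficient \<open>a\<close> (1 or 3/2),
  and turns their Wronskian property into nonvanishing of all derivatives at R^2.\<close>

lemma helmholtz_green_profile:
  fixes k R :: real
  assumes "k > 0" "R > 0"
  obtains \<phi> where "\<phi> holomorphic_on {s. 0 < Re s}" "\<And>n. (deriv ^^ n) \<phi> (of_real (R\<^sup>2)) \<noteq> 0"
    "\<And>x y :: 'a::euclidean_space. x \<noteq> y \<Longrightarrow> cnj (helmholtz_green k x y) = \<phi> (of_real ((dist x y)\<^sup>2))"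
proof -
  have "\<exists>f f' f'' a. (\<forall>s. 0 < Re s \<longrightarrow> (f has_field_derivative f' s) (at s)) \<and>
    (\<forall>s. 0 < Re s \<longrightarrow> (f' has_field_derivative f'' s) (at s)) \<and>
    (\<forall>s. 0 < Re s \<longrightarrow> s * f'' s + of_real a * f' s + of_real (k\<^sup>2 / 4) * f s = 0) \<and>
    (\<forall>r :: real. r > 0 \<longrightarrow> Im (cnj (f (complex_of_real r)) * f' (complex_of_real r)) \<noteq> 0) \<and>
    (\<forall>x y :: 'a. x \<noteq> y \<longrightarrow> cnj (helmholtz_green k x y) = f (of_real ((dist x y)\<^sup>2)))"
  proof (cases "DIM('a) = 2")
    case True
    show ?thesis by (rule helmholtz_profile_2d[OF \<open>k > 0\<close> True]) blast
  next
    case False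
    show ?thesis by (rule helmholtz_profile_3d[OF \<open>k > 0\<close> False]) blast
  qed
  then obtain f f' f'' a where
    f': "\<And>s. 0 < Re s \<Longrightarrow> (f has_field_derivative f' s) (at s)" and
    f'': "\<And>s. 0 < Re s \<Longrightarrow> (f' has_field_derivative f'' s) (at s)" and
    ode: "\<And>s. 0 < Re s \<Longrightarrow> s * f'' s + of_real a * f' s + of_real (k\<^sup>2 / 4) * f s = 0" and
    w: "\<And>r :: real. r > 0 \<Longrightarrow> Im (cnj (f (complex_of_real r)) * f' (complex_of_real r)) \<noteq> 0" and
    green: "\<And>x y :: 'a. x \<noteq> y \<Longrightarrow> cnj (helmholtz_green k x y) = f (of_real ((dist x y)\<^sup>2))"
    by blast
  have H: "open {s. 0 < Re s}" by (rule open_halfspace_Re_gt)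
  have "f holomorphic_on {s. 0 < Re s}"
    unfolding holomorphic_on_open[OF H] using f' by blast
  moreover have "(deriv ^^ n) f (of_real (R\<^sup>2)) \<noteq> 0" for n
  proof (rule higher_deriv_nonzero_of_ode[OF H, where a = a and c = "k\<^sup>2 / 4" and f'' = f''])
    show "Im (cnj (f (of_real (R\<^sup>2))) * f' (of_real (R\<^sup>2))) \<noteq> 0" by (rule w) (use \<open>R > 0\<close> in simp)
  qed (use f' f'' ode assms in auto)
  ultimately show thesis by (rule that) (rule green)
qed

section \<open>Injectivity\<close>

lemma
  fixes R :: real
  assumes "R > 0"
  shows sets_sphere_surface_measure: "sets (sphere_surface_measure R :: 'a::euclidean_space measure) = sets borel"
    and finite_measure_sphere_surface_measure: "finite_measure (sphere_surface_measure R :: 'a measure)"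
    and AE_sphere_surface_measure: "AE y in (sphere_surface_measure R :: 'a measure). norm y = R"
proof -
  define B where "B = restrict_space lborel (ball (0::'a) R)"
  define N where "N = density B (\<lambda>_. ennreal (real DIM('a) / R))"
  define p where "p = (\<lambda>x::'a. (R / norm x) *\<^sub>R x)"
  have \<sigma>: "sphere_surface_measure R = distr N borel p"
    by (simp add: sphere_surface_measure_def N_def B_def p_def)
  show "sets (sphere_surface_measure R :: 'a measure) = sets borel" by (simp add: \<sigma>)
  have "p \<in> borel_measurable lborel" unfolding p_def by measurable
  hence p: "p \<in> measurable N borel"
    by (simp add: N_def B_def measurable_restrict_space1)
  have "emeasure N (space N) = ennreal (real DIM('a) / R) * emeasure B (space B)"
    unfolding N_def by (subst emeasure_density_const) auto
  also have "emeasure B (space B) = emeasure lborel (ball (0::'a) R)"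
    by (simp add: B_def emeasure_restrict_space space_restrict_space)
  finally have "emeasure N (space N) \<noteq> \<infinity>"
    using emeasure_lborel_ball_finite[of "0::'a" R] by (auto simp: ennreal_mult_eq_top_iff)
  hence "finite_measure N" by (rule finite_measureI)
  thus "finite_measure (sphere_surface_measure R :: 'a measure)"
    unfolding \<sigma> using finite_measure.finite_measure_distr p by blast
  \<comment> \<open>The origin is the only point that the radial projection does not send to the
    sphere: division by zero gives \<open>p 0 = 0\<close>. It is a null set.\<close>
  have "AE x in lborel. x \<noteq> (0::'a)" by (rule AE_lborel_singleton)
  hence "AE x in B. norm (p x) = R"
    unfolding B_def using \<open>R > 0\<close>
    by (subst AE_restrict_space_iff) (auto simp: p_def elim!: eventually_mono)
  hence "AE x in N. norm (p x) = R"
    unfolding N_def by (subst AE_density) auto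
  thus "AE y in (sphere_surface_measure R :: 'a measure). norm y = R"
    unfolding \<sigma> by (subst AE_distr_iff[OF p]) auto
qed

theorem theorem1:
  fixes k R :: real and \<Omega> :: "'a::euclidean_space set" and u1 u2 :: "'a \<Rightarrow> complex"
  assumes "DIM('a) = 2 \<or> DIM('a) = 3"
    and "k > 0" and "R > 0"
    and "open \<Omega>" and "\<Omega> \<noteq> {}" and "\<Omega> \<subseteq> ball 0 R"
    and "in_L2_sphere R u1" and "in_L2_sphere R u2"
    and "\<forall>x\<in>\<Omega>. helmholtz_T k R u1 x = helmholtz_T k R u2 x"
  shows "AE y in sphere_surface_measure R. u1 y = u2 y"
proof -
  define \<sigma> where "\<sigma> = (sphere_surface_measure R :: 'a measure)"
  note sets_\<sigma> = sets_sphere_surface_measure[OF \<open>R > 0\<close>, where 'a = 'a, folded \<sigma>_def]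
  note AE_\<sigma> = AE_sphere_surface_measure[OF \<open>R > 0\<close>, where 'a = 'a, folded \<sigma>_def]
  interpret finite_measure \<sigma>
    unfolding \<sigma>_def by (rule finite_measure_sphere_surface_measure[OF \<open>R > 0\<close>])
  have space_\<sigma>: "space \<sigma> = UNIV" using sets_eq_imp_space_eq[OF sets_\<sigma>] by simp
  \<comment> \<open>The surface measure lives on the whole space but charges only the sphere.
    Restricting it makes the underlying space compact, as the lemmas above demand.\<close>
  define M where "M = restrict_space \<sigma> (sphere 0 R)"
  have sphere: "sphere 0 R \<in> sets \<sigma>" by (simp add: sets_\<sigma>)
  have sets_M: "sets M = sets (restrict_space borel (sphere 0 R))"
    unfolding M_def by (rule sets_restrict_space_cong[OF sets_\<sigma>])
  have fin_M: "finite_measure M"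
    unfolding M_def by (rule finite_measure_restrict_space) (use sphere finite_measure_axioms in auto)
  obtain \<phi> where hol: "\<phi> holomorphic_on {s. 0 < Re s}"
    and deriv_nz: "\<And>n. (deriv ^^ n) \<phi> (of_real (R\<^sup>2)) \<noteq> 0"
    and green: "\<And>x y :: 'a. x \<noteq> y \<Longrightarrow> cnj (helmholtz_green k x y) = \<phi> (of_real ((dist x y)\<^sup>2))"
    by (rule helmholtz_green_profile[OF \<open>k > 0\<close> \<open>R > 0\<close>]) (rule that)
  have L1: "integrable \<sigma> u" if "in_L2_sphere R u" for u :: "'a \<Rightarrow> complex"
  proof (rule Bochner_Integration.integrable_bound)
    show "integrable \<sigma> (\<lambda>y. 1 + (cmod (u y))\<^sup>2)"
      using that by (simp add: in_L2_sphere_def \<sigma>_def[symmetric])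
    show "u \<in> borel_measurable \<sigma>" using that by (simp add: in_L2_sphere_def \<sigma>_def)
    \<comment> \<open>Square integrability implies integrability because the measure is
      finite.\<close>
    have "r \<le> 1 + r\<^sup>2" for r :: real using sum_squares_bound[of 1 r] zero_le_power2[of r] unfolding power_one by linarith
    thus "AE y in \<sigma>. cmod (u y) \<le> norm (1 + (cmod (u y))\<^sup>2)"
      by (intro AE_I2) (simp add: add_nonneg_nonneg)
  qed
  have kernel_cont: "continuous_on (- {x}) (\<lambda>y. \<phi> (of_real ((dist x y)\<^sup>2)))" for x :: 'a
    by (rule continuous_on_compose2[OF holomorphic_on_imp_continuous_on[OF hol]])
      (auto intro!: continuous_intros)
  have T_eq: "helmholtz_T k R u x = (\<integral>y. u y * \<phi> (of_real ((dist x y)\<^sup>2)) \<partial>M)"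
    and T_int: "integrable M (\<lambda>y. u y * \<phi> (of_real ((dist x y)\<^sup>2)))"
    if u: "in_L2_sphere R u" and x: "x \<in> ball 0 R" for u x
  proof -
    let ?g = "\<lambda>y. u y * cnj (helmholtz_green k x y)"
    \<comment> \<open>At y = x the kernel takes only a conventional value; one exceptional point
      does not harm Borel measurability, and it lies off the sphere.\<close>
    have "continuous_on (- {x}) (\<lambda>y. cnj (helmholtz_green k x y))"
      using kernel_cont[of x] by (rule continuous_on_eq) (use green in auto)
    hence "(\<lambda>y. cnj (helmholtz_green k x y)) \<in> borel_measurable borel"
      by (intro borel_measurable_continuous_countable_exceptions[of "{x}"]) auto
    hence "(\<lambda>y. cnj (helmholtz_green k x y)) \<in> borel_measurable \<sigma>"
      using measurable_cong_sets[OF sets_\<sigma> refl] by blast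
    hence g: "?g \<in> borel_measurable \<sigma>"
      using borel_measurable_integrable[OF L1[OF u]] by measurable
    have "helmholtz_T k R u x = (\<integral>y. indicator (sphere 0 R) y *\<^sub>R ?g y \<partial>\<sigma>)"
      unfolding helmholtz_T_def \<sigma>_def[symmetric]
    proof (rule integral_cong_AE)
      show "(\<lambda>y. indicator (sphere 0 R) y *\<^sub>R ?g y) \<in> borel_measurable \<sigma>"
        using g sphere by measurable
      show "AE y in \<sigma>. ?g y = indicator (sphere 0 R) y *\<^sub>R ?g y"
        using AE_\<sigma> by eventually_elim simp
    qed (rule g)
    also have "\<dots> = (\<integral>y. ?g y \<partial>M)"
      unfolding M_def by (rule integral_restrict_space[symmetric]) (use sphere space_\<sigma> in simp)
    also have "\<dots> = (\<integral>y. u y * \<phi> (of_real ((dist x y)\<^sup>2)) \<partial>M)"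
    proof (rule Bochner_Integration.integral_cong[OF refl])
      fix y assume "y \<in> space M"
      hence "x \<noteq> y" using x by (auto simp: M_def space_restrict_space)
      thus "?g y = u y * \<phi> (of_real ((dist x y)\<^sup>2))" using green by simp
    qed
    finally show "helmholtz_T k R u x = (\<integral>y. u y * \<phi> (of_real ((dist x y)\<^sup>2)) \<partial>M)" .
    have "integrable M u"
      unfolding M_def using integrable_mult_indicator[OF sphere L1[OF u]] sphere space_\<sigma>
      by (subst integrable_restrict_space) auto
    thus "integrable M (\<lambda>y. u y * \<phi> (of_real ((dist x y)\<^sup>2)))"
      by (rule integrable_mult_continuous[OF compact_sphere sets_M _ continuous_on_subset[OF kernel_cont]])
        (use x in auto)
  qed
  define u where "u = (\<lambda>y. u1 y - u2 y)"
  have "integrable \<sigma> u" unfolding u_def using L1 assms(7,8) by simp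
  hence u_int: "integrable M u"
    unfolding M_def using integrable_mult_indicator[OF sphere] sphere space_\<sigma>
    by (subst integrable_restrict_space) auto
  have zero: "(\<integral>y. u y * \<phi> (of_real ((dist x y)\<^sup>2)) \<partial>M) = 0" if "x \<in> \<Omega>" for x
  proof -
    have x: "x \<in> ball 0 R" using that assms(6) by blast
    have "(\<integral>y. u y * \<phi> (of_real ((dist x y)\<^sup>2)) \<partial>M) = helmholtz_T k R u1 x - helmholtz_T k R u2 x"
      unfolding T_eq[OF assms(7) x] T_eq[OF assms(8) x] u_def left_diff_distrib
      by (rule Bochner_Integration.integral_diff[OF T_int[OF assms(7) x] T_int[OF assms(8) x]])
    thus ?thesis using assms(9) that by simp
  qed
  have "AE y in M. u y = 0"
  proof (rule AE_eq_0_if_moments_eq_0[OF fin_M compact_sphere sets_M u_int])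
    show "(\<integral>y. u y * of_real (b \<bullet> y) ^ n \<partial>M) = 0" for b n
      by (rule sphere_moments_eq_0[OF sets_M \<open>R > 0\<close> u_int hol deriv_nz
            sphere_potential_continuation[OF sets_M u_int hol assms(4-6) zero]])
  qed
  hence "AE y in \<sigma>. y \<in> sphere 0 R \<longrightarrow> u y = 0"
    unfolding M_def using sphere space_\<sigma> by (subst (asm) AE_restrict_space_iff) auto
  with AE_\<sigma> have "AE y in \<sigma>. u1 y = u2 y" by eventually_elim (simp add: u_def)
  thus ?thesis unfolding \<sigma>_def .
qed

end
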